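(* Let $W$ be a recurrent infinite word, $S$ a Rauzy scheme for $W$, and $v$ a support edge of $S$; construct the graphs $S'$ and $S''$ as described in the context. Then $S''$ is strongly connected. If $S''$ is a cycle, then $W$ is periodic. If $S''$ is not a cycle, then $S''$, equipped with the words described in the context, is a Rauzy scheme for $W$ (it is called the elementary evolution of $S$ along $v$).
   Context: An infinite word is recurrent if every factor occurs infinitely often, and periodic if it equals $uuu\cdots$ for a nonempty finite word $u$. $u\sqsubseteq w$: $u$ is a factor of $w$; $u\sqsubseteq_k w$: $u$ occurs in $w$ at least $k$ times. A graph with words is a strongly connected finite directed graph (multiple edges and loops allowed) in which every edge $e$ carries a front word $F(e)$ and a back word $B(e)$, and every vertex either has in-degree $1$ and out-degree $>1$ (distributing vertex) or in-degree $>1$ and out-degree $1$ (collecting vertex). A path is a finite nonempty sequence of edges $v_1\dots v_n$ with each $v_{i+1}$ starting where $v_i$ ends; subpaths and $s_1\sqsubseteq_k s_2$ are defined via edge records. A path is symmetric if its first edge starts at a collecting vertex and its last edge ends at a distributing vertex. For $s=v_1\dots v_n$, $F(s)$ is the concatenation, in order, of the front words of $v_1$ and of all $v_i$ ($i\ge2$) starting at a distributing vertex; $B(s)$ is the concatenation, in order, of the back words of all $v_i$ ($i\le n-1$) ending at a collecting vertex and of $v_n$. A Rauzy scheme for $W$ is a graph with words such that: (1) it has more than one edge; (2) front words of edges leaving a common distributing vertex have pairwise distinct first letters, and back words of edges entering a common collecting vertex have pairwise distinct last letters; (3) $F(s)=B(s)$ for every symmetric path $s$; (4) for symmetric paths $s_1,s_2$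 and $k\ge1$, $F(s_1)\sqsubseteq_k F(s_2)$ implies $s_1\sqsubseteq_k s_2$; (5) all words on edges are factors of $W$; (6) every factor of $W$ is a factor of $F(s)$ for some symmetric path $s$; (7) for every edge $e$ there is a factor $u_e$ of $W$ such that every symmetric path $s$ with $u_e\sqsubseteq F(s)$ passes through $e$. A support edge is an edge going from a collecting vertex to a distributing vertex; for it $F(v)=B(v)=:V$. In a strongly connected directed graph that is not a cycle and whose vertices are all distributing or collecting, the natural right extension of a path $s$ is the shortest path having $s$ as a prefix and ending at a distributing vertex, and the natural left extension is the shortest path having $s$ as a suffix and starting at a collecting vertex. Construction. Let $x_1,\dots,x_p$ be the edges entering the start of $v$ and $y_1,\dots,y_q$ the edges leaving the end of $v$; put $X_i=B(x_i)$, $Y_j=F(y_j)$. The pair $(i,j)$ is good if $X_iVY_j\sqsubseteq W$ and bad otherwise. The graph $S'$ is obtained from $S$ by deleting $v$, replacing its start by $p$ vertices $A_1,\dots,A_p$ with $x_i$ entering $A_i$, replacing its end by $q$ vertices $B_1,\dots,B_q$ with $y_j$ leaving $B_j$, and adding edges $v_{ij}\colon A_i\to B_j$ for all $i,j$. Words in $S'$: the front word of $y_j$ is $VY_j$, the back word of $x_i$ is $X_iV$, the front word of $v_{ij}$ is $Y_j$ and its back word is $X_i$; all other front and back words are copied from $S$. The edges $v_{ij}$ with $(i,j)$ bad are bad; all other edges of $S'$ are good. A vertex of $S'$ is persistent if at least two good edges leave it or at least two good edges enter it. The vertices of $S''$ are the persistent vertices of $S'$, and the edges of $S''$ correspond to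 paths in $S'$ consisting of good edges, starting and ending at persistent vertices, with no persistent interior vertex. If $S''$ is not a cycle, the front word of an edge $e$ of $S''$ is $F$ (computed in $S'$) of the path of $S'$ corresponding to the natural right extension of $e$ in $S''$, and its back word is $B$ (computed in $S'$) of the path of $S'$ corresponding to the natural left extension of $e$ in $S''$. *)

theory Defs
  imports Main
begin

section \<open>Words\<close>

text \<open>Finite words are lists, infinite words are functions nat => 'a.\<close>

definition factor :: "'a list \<Rightarrow> (nat \<Rightarrow> 'a) \<Rightarrow> bool" where
  "factor u W \<longleftrightarrow> (\<exists>i. u = map W [i..<i + length u])"

definition recurrent :: "(nat \<Rightarrow> 'a) \<Rightarrow> bool" where
  "recurrent W \<longleftrightarrow>
     (\<forall>u. factor u W \<longrightarrow> infinite {i. map W [i..<i + length u] = u})"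

definition periodic :: "(nat \<Rightarrow> 'a) \<Rightarrow> bool" where
  "periodic W \<longleftrightarrow> (\<exists>u. u \<noteq> [] \<and> (\<forall>n. W n = u ! (n mod length u)))"

text \<open>Factor of a finite word (list) and number of occurrences.\<close>

definition lfactor :: "'b list \<Rightarrow> 'b list \<Rightarrow> bool" where
  "lfactor u w \<longleftrightarrow> (\<exists>a b. w = a @ u @ b)"

definition occ :: "'b list \<Rightarrow> 'b list \<Rightarrow> nat" where
  "occ u w = card {i. i + length u \<le> length w \<and> take (length u) (drop i w) = u}"

section \<open>Graphs with words\<close>

record ('v, 'e, 'a) gw =
  gverts :: "'v set"
  gedges :: "'e set"
  gsrc :: "'e \<Rightarrow> 'v"
  gtgt :: "'e \<Rightarrow> 'v"
  gfw :: "'e \<Rightarrow> 'a list"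
  gbw :: "'e \<Rightarrow> 'a list"

definition indeg :: "('v, 'e, 'a) gw \<Rightarrow> 'v \<Rightarrow> nat" where
  "indeg G u = card {e \<in> gedges G. gtgt G e = u}"

definition outdeg :: "('v, 'e, 'a) gw \<Rightarrow> 'v \<Rightarrow> nat" where
  "outdeg G u = card {e \<in> gedges G. gsrc G e = u}"

definition distr :: "('v, 'e, 'a) gw \<Rightarrow> 'v \<Rightarrow> bool" where
  "distr G u \<longleftrightarrow> indeg G u = 1 \<and> outdeg G u > 1"

definition coll :: "('v, 'e, 'a) gw \<Rightarrow> 'v \<Rightarrow> bool" where
  "coll G u \<longleftrightarrow> indeg G u > 1 \<and> outdeg G u = 1"

definition adj :: "('v, 'e, 'a) gw \<Rightarrow> ('v \<times> 'v) set" where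
  "adj G = {(gsrc G e, gtgt G e) | e. e \<in> gedges G}"

definition strongly_connected :: "('v, 'e, 'a) gw \<Rightarrow> bool" where
  "strongly_connected G \<longleftrightarrow> (\<forall>u\<in>gverts G. \<forall>w\<in>gverts G. (u, w) \<in> (adj G)\<^sup>*)"

text \<open>A directed cycle: every vertex has in-degree 1 and out-degree 1
  (used for strongly connected graphs; the graph without vertices counts as a
  degenerate cycle).\<close>

definition is_cycle :: "('v, 'e, 'a) gw \<Rightarrow> bool" where
  "is_cycle G \<longleftrightarrow> (\<forall>u\<in>gverts G. indeg G u = 1 \<and> outdeg G u = 1)"

definition well_formed :: "('v, 'e, 'a) gw \<Rightarrow> bool" where
  "well_formed G \<longleftrightarrow> finite (gverts G) \<and> finite (gedges G) \<and>
     (\<forall>e\<in>gedges G. gsrc G e \<in> gverts G \<and> gtgt G e \<in> gverts G)"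

definition graph_with_words :: "('v, 'e, 'a) gw \<Rightarrow> bool" where
  "graph_with_words G \<longleftrightarrow> well_formed G \<and> strongly_connected G \<and>
     (\<forall>u\<in>gverts G. distr G u \<or> coll G u)"

text \<open>Paths are nonempty lists of consecutive edges.\<close>

definition is_path :: "('v, 'e, 'a) gw \<Rightarrow> 'e list \<Rightarrow> bool" where
  "is_path G p \<longleftrightarrow> p \<noteq> [] \<and> set p \<subseteq> gedges G \<and>
     (\<forall>i. Suc i < length p \<longrightarrow> gtgt G (p ! i) = gsrc G (p ! Suc i))"

definition symmetric_path :: "('v, 'e, 'a) gw \<Rightarrow> 'e list \<Rightarrow> bool" where
  "symmetric_path G p \<longleftrightarrow> is_path G p \<and> coll G (gsrc G (hd p)) \<and> distr G (gtgt G (last p))"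

definition Fw :: "('v, 'e, 'a) gw \<Rightarrow> 'e list \<Rightarrow> 'a list" where
  "Fw G p = gfw G (hd p) @ concat (map (gfw G) (filter (\<lambda>e. distr G (gsrc G e)) (tl p)))"

definition Bw :: "('v, 'e, 'a) gw \<Rightarrow> 'e list \<Rightarrow> 'a list" where
  "Bw G p = concat (map (gbw G) (filter (\<lambda>e. coll G (gtgt G e)) (butlast p))) @ gbw G (last p)"

section \<open>Rauzy schemes\<close>

definition rauzy_scheme :: "('v, 'e, 'a) gw \<Rightarrow> (nat \<Rightarrow> 'a) \<Rightarrow> bool" where
  "rauzy_scheme G W \<longleftrightarrow>
     graph_with_words G \<and>
     \<comment> \<open>(1)\<close>
     card (gedges G) > 1 \<and>
     \<comment> \<open>(2)\<close>
     (\<forall>u\<in>gverts G. distr G u \<longrightarrow>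
        (\<forall>e1\<in>gedges G. \<forall>e2\<in>gedges G. gsrc G e1 = u \<and> gsrc G e2 = u \<and> e1 \<noteq> e2 \<longrightarrow>
           gfw G e1 \<noteq> [] \<and> gfw G e2 \<noteq> [] \<and> hd (gfw G e1) \<noteq> hd (gfw G e2))) \<and>
     (\<forall>u\<in>gverts G. coll G u \<longrightarrow>
        (\<forall>e1\<in>gedges G. \<forall>e2\<in>gedges G. gtgt G e1 = u \<and> gtgt G e2 = u \<and> e1 \<noteq> e2 \<longrightarrow>
           gbw G e1 \<noteq> [] \<and> gbw G e2 \<noteq> [] \<and> last (gbw G e1) \<noteq> last (gbw G e2))) \<and>
     \<comment> \<open>(3)\<close>
     (\<forall>s. symmetric_path G s \<longrightarrow> Fw G s = Bw G s) \<and>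
     \<comment> \<open>(4)\<close>
     (\<forall>s1 s2 k. symmetric_path G s1 \<and> symmetric_path G s2 \<and> k \<ge> 1 \<and>
        occ (Fw G s1) (Fw G s2) \<ge> k \<longrightarrow> occ s1 s2 \<ge> k) \<and>
     \<comment> \<open>(5)\<close>
     (\<forall>e\<in>gedges G. factor (gfw G e) W \<and> factor (gbw G e) W) \<and>
     \<comment> \<open>(6)\<close>
     (\<forall>u. factor u W \<longrightarrow> (\<exists>s. symmetric_path G s \<and> lfactor u (Fw G s))) \<and>
     \<comment> \<open>(7)\<close>
     (\<forall>e\<in>gedges G. \<exists>u. factor u W \<and>
        (\<forall>s. symmetric_path G s \<and> lfactor u (Fw G s) \<longrightarrow> e \<in> set s))"

definition support_edge :: "('v, 'e, 'a) gw \<Rightarrow> 'e \<Rightarrow> bool" where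
  "support_edge G v \<longleftrightarrow> v \<in> gedges G \<and> coll G (gsrc G v) \<and> distr G (gtgt G v)"

section \<open>Natural extensions\<close>

definition nat_rext :: "('v, 'e, 'a) gw \<Rightarrow> 'e list \<Rightarrow> 'e list" where
  "nat_rext G s = (SOME p. is_path G p \<and> take (length s) p = s \<and> distr G (gtgt G (last p)) \<and>
      (\<forall>q. is_path G q \<and> take (length s) q = s \<and> distr G (gtgt G (last q))
           \<longrightarrow> length p \<le> length q))"

definition nat_lext :: "('v, 'e, 'a) gw \<Rightarrow> 'e list \<Rightarrow> 'e list" where
  "nat_lext G s = (SOME p. is_path G p \<and> drop (length p - length s) p = s \<and> length s \<le> length p \<and>
      coll G (gsrc G (hd p)) \<and>
      (\<forall>q. is_path G q \<and> drop (length q - length s) q = s \<and> length s \<le> length q \<and>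
           coll G (gsrc G (hd q)) \<longrightarrow> length p \<le> length q))"

section \<open>The construction of S' and S''\<close>

datatype ('v, 'e) vx = Old 'v | InA 'e | OutB 'e
datatype 'e ex = OldE 'e | New 'e 'e

text \<open>Vertex \<open>InA x\<close> is A_i for the edge x = x_i entering the start of v;
  vertex \<open>OutB y\<close> is B_j for the edge y = y_j leaving the end of v;
  edge \<open>New x y\<close> is v_ij.\<close>

definition xs_in :: "('v, 'e, 'a) gw \<Rightarrow> 'e \<Rightarrow> 'e set" where
  "xs_in S v = {x \<in> gedges S. gtgt S x = gsrc S v}"

definition ys_out :: "('v, 'e, 'a) gw \<Rightarrow> 'e \<Rightarrow> 'e set" where
  "ys_out S v = {y \<in> gedges S. gsrc S y = gtgt S v}"

definition S1 :: "('v, 'e, 'a) gw \<Rightarrow> 'e \<Rightarrow> (('v, 'e) vx, 'e ex, 'a) gw" where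
  "S1 S v = \<lparr>
     gverts = Old ` (gverts S - {gsrc S v, gtgt S v}) \<union> InA ` xs_in S v \<union> OutB ` ys_out S v,
     gedges = OldE ` (gedges S - {v}) \<union> {New x y | x y. x \<in> xs_in S v \<and> y \<in> ys_out S v},
     gsrc = (\<lambda>\<epsilon>. case \<epsilon> of
               OldE e \<Rightarrow> (if gsrc S e = gtgt S v then OutB e else Old (gsrc S e))
             | New x y \<Rightarrow> InA x),
     gtgt = (\<lambda>\<epsilon>. case \<epsilon> of
               OldE e \<Rightarrow> (if gtgt S e = gsrc S v then InA e else Old (gtgt S e))
             | New x y \<Rightarrow> OutB y),
     gfw = (\<lambda>\<epsilon>. case \<epsilon> of
               OldE e \<Rightarrow> (if gsrc S e = gtgt S v then gfw S v @ gfw S e else gfw S e)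
             | New x y \<Rightarrow> gfw S y),
     gbw = (\<lambda>\<epsilon>. case \<epsilon> of
               OldE e \<Rightarrow> (if gtgt S e = gsrc S v then gbw S e @ gfw S v else gbw S e)
             | New x y \<Rightarrow> gbw S x) \<rparr>"

definition good :: "('v, 'e, 'a) gw \<Rightarrow> (nat \<Rightarrow> 'a) \<Rightarrow> 'e \<Rightarrow> 'e ex \<Rightarrow> bool" where
  "good S W v \<epsilon> = (case \<epsilon> of
      OldE e \<Rightarrow> True
    | New x y \<Rightarrow> factor (gbw S x @ gfw S v @ gfw S y) W)"

definition persistent :: "('v, 'e, 'a) gw \<Rightarrow> (nat \<Rightarrow> 'a) \<Rightarrow> 'e \<Rightarrow> ('v, 'e) vx \<Rightarrow> bool" where
  "persistent S W v u \<longleftrightarrow> u \<in> gverts (S1 S v) \<and>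
     (2 \<le> card {\<epsilon> \<in> gedges (S1 S v). good S W v \<epsilon> \<and> gsrc (S1 S v) \<epsilon> = u} \<or>
      2 \<le> card {\<epsilon> \<in> gedges (S1 S v). good S W v \<epsilon> \<and> gtgt (S1 S v) \<epsilon> = u})"

text \<open>Edges of S'' are the corresponding paths of S'.\<close>

definition S2_edges :: "('v, 'e, 'a) gw \<Rightarrow> (nat \<Rightarrow> 'a) \<Rightarrow> 'e \<Rightarrow> 'e ex list set" where
  "S2_edges S W v = {p. is_path (S1 S v) p \<and> (\<forall>\<epsilon>\<in>set p. good S W v \<epsilon>) \<and>
      persistent S W v (gsrc (S1 S v) (hd p)) \<and> persistent S W v (gtgt (S1 S v) (last p)) \<and>
      (\<forall>i. Suc i < length p \<longrightarrow> \<not> persistent S W v (gtgt (S1 S v) (p ! i)))}"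

definition S2_top :: "('v, 'e, 'a) gw \<Rightarrow> (nat \<Rightarrow> 'a) \<Rightarrow> 'e \<Rightarrow> (('v, 'e) vx, 'e ex list, 'a) gw" where
  "S2_top S W v = \<lparr>
     gverts = {u. persistent S W v u},
     gedges = S2_edges S W v,
     gsrc = (\<lambda>p. gsrc (S1 S v) (hd p)),
     gtgt = (\<lambda>p. gtgt (S1 S v) (last p)),
     gfw = (\<lambda>_. []),
     gbw = (\<lambda>_. []) \<rparr>"

definition S2 :: "('v, 'e, 'a) gw \<Rightarrow> (nat \<Rightarrow> 'a) \<Rightarrow> 'e \<Rightarrow> (('v, 'e) vx, 'e ex list, 'a) gw" where
  "S2 S W v = (S2_top S W v)\<lparr>
     gfw := (\<lambda>p. Fw (S1 S v) (concat (nat_rext (S2_top S W v) [p]))),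
     gbw := (\<lambda>p. Bw (S1 S v) (concat (nat_lext (S2_top S W v) [p]))) \<rparr>"

end

theory Submission
  imports Defs "HOL-Library.Sublist"
begin

text \<open>Condition (4), applied to all occurrences at once, says that the word of a symmetric path
  occurs in the word of another one exactly where the path itself occurs. Hence a factor
  $X_i V Y_j$ of $W$ forces every symmetric path reading it to pass through $x_i v y_j$, so every
  good edge of $S'$ has a marker word in $W$. By recurrence $W$ contains any two markers far apart
  and in a prescribed order; a symmetric path reading such a factor can be trimmed, at a bounded
  cost, to one whose own word is a factor of $W$. So any two good edges of $S'$ are joined by good
  paths inside paths with words in $W$. This gives strong connectivity, condition (6), and
  condition (5), because the natural extensions are forced and must occur inside such paths.
  Symmetric paths of $S''$, $S'$ and $S$ correspond to each other with equal words, which transfers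
  conditions (3) and (4).\<close>

section \<open>Words\<close>

text \<open>The scheme restricts edge words and markers, but not the words of symmetric paths: a
  symmetric path of S passing through a bad pair reads a word outside \<open>W\<close>. Only paths
  whose own word lies in \<open>W\<close> lift to S' along good edges, and this is what the trimming
  is for. It is cheap because F and B change by one edge word at a time, so margins as long as the
  longest edge word absorb the cuts. Conditions (2)-(4) pass to all of S', good and bad edges alike.
  A bad edge, however, can have no marker, since every factor of \<open>W\<close> is read by a path
  of good edges; (7) forces its removal. This leaves vertices with one good edge in and one out, and
  suppressing them turns the edges of S'' into blocks of edges of S'. The obstacle in comparing S'
  with S lies at \<open>v\<close>: splitting its ends shifts where words are read, and a
  \<open>v\<close> at an end of a path lacks a neighbour that would tell which \<open>v_ij\<close>
  it stands for.\<close>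

lemma lfactor_sublist: "lfactor u w \<longleftrightarrow> sublist u w"
  by (auto simp: lfactor_def sublist_def)

lemma factor_iff_nth: "factor u W \<longleftrightarrow> (\<exists>i. \<forall>j<length u. u ! j = W (i + j))"
  unfolding factor_def list_eq_iff_nth_eq by simp

lemma factor_mono:
  assumes "factor w W" "sublist u w"
  shows "factor u W"
proof -
  obtain a b where w: "w = a @ u @ b" using assms(2) by (auto simp: sublist_def)
  obtain i where i: "\<forall>j<length w. w ! j = W (i + j)" using assms(1) by (auto simp: factor_iff_nth)
  have "u ! j = W (i + length a + j)" if "j < length u" for j
    using i[rule_format, of "length a + j"] that by (simp add: w nth_append add.assoc)
  thus ?thesis by (auto simp: factor_iff_nth)
qed

lemma upt_append: "i \<le> j \<Longrightarrow> j \<le> k \<Longrightarrow> [i..<j] @ [j..<k] = [i..<k]"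
  by (metis le_Suc_ex upt_add_eq_append)

lemma append_cut_prefix:
  assumes "x @ y = s @ t" "length x \<le> length s"
  obtains z where "s = x @ z" "y = z @ t"
  using assms by (auto simp: append_eq_append_conv2)

lemma append_cut_suffix:
  assumes "x @ y = s @ t" "length y \<le> length t"
  obtains z where "t = z @ y" "x = s @ z"
  using assms arg_cong[OF assms(1), of length] by (auto simp: append_eq_append_conv2)

lemma recurrentD:
  assumes "recurrent W" "factor u W"
  obtains i where "n \<le> i" "map W [i..<i + length u] = u"
proof -
  have "infinite {i. map W [i..<i + length u] = u}" using assms by (auto simp: recurrent_def)
  thus ?thesis using that by (auto simp: finite_nat_set_iff_bounded not_less)
qed

text \<open>The margins \<open>a\<close>, \<open>c\<close> and the gap \<open>n\<close> are spare
  room: a path can only be cut at edge boundaries, so a cut keeps up to one edge word too much, and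
  this excess has to stay inside the window and away from the other words.\<close>

lemma recurrent_window:
  assumes rec: "recurrent W" and "factor u W" "factor w W" "factor x W"
  obtains a m n c where "factor (a @ u @ m @ w @ n @ x @ c) W"
    "length a = k" "length c = k" "k' \<le> length n"
proof -
  obtain i where i: "k \<le> i" "map W [i..<i + length u] = u"
    using recurrentD[OF rec assms(2)] by metis
  obtain j where j: "i + length u \<le> j" "map W [j..<j + length w] = w"
    using recurrentD[OF rec assms(3)] by metis
  obtain l where l: "j + length w + k' \<le> l" "map W [l..<l + length x] = x"
    using recurrentD[OF rec assms(4)] by metis
  have "map W [i - k..<l + length x + k] = map W [i-k..<i] @ u @ map W [i + length u..<j] @ w @
    map W [j + length w..<l] @ x @ map W [l + length x..<l + length x + k]"
    (is "_ = ?R")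
  proof -
    have "[i - k..<l + length x + k] = [i-k..<i] @ [i..<i+length u] @ [i + length u..<j] @ [j..<j+length w] @
    [j + length w..<l] @ [l..<l+length x] @ [l + length x..<l + length x + k]"
      using i(1) j(1) l(1) by (simp add: upt_append add.assoc)
    thus ?thesis by (simp only: map_append i(2) j(2) l(2))
  qed
  moreover have "factor (map W [i - k..<l + length x + k]) W"
    unfolding factor_def by (rule exI[of _ "i-k"]) (use i(1) j(1) l(1) in \<open>simp add: add.assoc\<close>)
  ultimately have "factor ?R W" by simp
  thus ?thesis using that i(1) j(1) l(1) by (metis add_diff_cancel_left' add_le_imp_le_diff add.commute diff_diff_cancel length_map length_upt)
qed

lemma occ_set: "{i. i + length u \<le> length w \<and> take (length u) (drop i w) = u}
  = {i. \<exists>a b. w = a @ u @ b \<and> length a = i}"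
proof safe
  fix i assume "i + length u \<le> length w" "take (length u) (drop i w) = u"
  hence "w = take i w @ u @ drop (length u + i) w" by (metis append_take_drop_id drop_drop)
  thus "\<exists>a b. w = a @ u @ b \<and> length a = i" using \<open>i + length u \<le> length w\<close>
    by (metis add_leD1 length_take min.absorb2)
qed auto

lemma occ_alt: "occ u w = card {i. \<exists>a b. w = a @ u @ b \<and> length a = i}"
  unfolding occ_def occ_set ..

lemma finite_occ: "finite {i. \<exists>a b. w = a @ u @ b \<and> length a = i}"
  by (rule finite_subset[of _ "{..length w}"]) auto

text \<open>\<open>h\<close> recovers the position of the original occurrence from the prefix in
  front of the matched one, so the occurrences of \<open>u'\<close> map onto those of
  \<open>u\<close>. A function of the prefix is used because positions may be rescaled, for instance
  when blocks are flattened.\<close>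

lemma occ_le:
  assumes "\<And>a b. w = a @ u @ b \<Longrightarrow> \<exists>a' b'. w' = a' @ u' @ b' \<and> h a' = length a"
  shows "occ u w \<le> occ u' w'"
proof -
  let ?I = "{i. \<exists>a b. w = a @ u @ b \<and> length a = i}"
  let ?I' = "{i. \<exists>a b. w' = a @ u' @ b \<and> length a = i}"
  have "?I \<subseteq> (\<lambda>i. h (take i w')) ` ?I'"
  proof
    fix i assume "i \<in> ?I"
    then obtain a b where "w = a @ u @ b" "length a = i" by blast
    then obtain a' b' where a': "w' = a' @ u' @ b'" "h a' = i" using assms by blast
    hence "i = h (take (length a') w')" by simp
    thus "i \<in> (\<lambda>i. h (take i w')) ` ?I'" using a'(1) by blast
  qed
  thus ?thesis unfolding occ_alt using finite_occ[of w' u'] by (meson card_image_le card_mono finite_imageI le_trans)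
qed

section \<open>Paths in graphs with words\<close>

lemma is_path_alt: "is_path G p \<longleftrightarrow> p \<noteq> [] \<and> set p \<subseteq> gedges G \<and>
    successively (\<lambda>a b. gtgt G a = gsrc G b) p"
  by (auto simp: is_path_def successively_conv_nth)

lemma is_path_append:
  "p \<noteq> [] \<Longrightarrow> q \<noteq> [] \<Longrightarrow> is_path G (p @ q) \<longleftrightarrow> is_path G p \<and> is_path G q \<and>
     gtgt G (last p) = gsrc G (hd q)"
  by (auto simp: is_path_alt successively_append_iff)

lemma is_path_Cons:
  "is_path G (e # p) \<longleftrightarrow> e \<in> gedges G \<and> (p \<noteq> [] \<longrightarrow> is_path G p \<and> gtgt G e = gsrc G (hd p))"
  by (cases p) (auto simp: is_path_alt)

lemma is_path_single: "is_path G [e] \<longleftrightarrow> e \<in> gedges G"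
  by (simp add: is_path_Cons)

lemma is_path_infix:
  "is_path G (l @ s @ r) \<Longrightarrow> s \<noteq> [] \<Longrightarrow> is_path G s"
  by (auto simp: is_path_alt successively_append_iff)

lemma is_path_nonempty: "is_path G p \<Longrightarrow> p \<noteq> []"
  by (simp add: is_path_def)

lemma is_path_edge: "is_path G p \<Longrightarrow> e \<in> set p \<Longrightarrow> e \<in> gedges G"
  by (auto simp: is_path_def)

lemma not_distr_coll: "distr G u \<Longrightarrow> \<not> coll G u"
  by (auto simp: distr_def coll_def)

text \<open>What an edge contributes when it is not the first edge of a path. With it
  \<open>Fw\<close> is one front word followed by an edgewise concatenation \<open>FF\<close>, so
  gluing paths becomes gluing words; \<open>gB\<close> is the mirror image for edges that are not
  last.\<close>

definition gF :: "('v, 'e, 'a) gw \<Rightarrow> 'e \<Rightarrow> 'a list" where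
  "gF G e = (if distr G (gsrc G e) then gfw G e else [])"

definition gB :: "('v, 'e, 'a) gw \<Rightarrow> 'e \<Rightarrow> 'a list" where
  "gB G e = (if coll G (gtgt G e) then gbw G e else [])"

abbreviation FF :: "('v, 'e, 'a) gw \<Rightarrow> 'e list \<Rightarrow> 'a list" where
  "FF G p \<equiv> concat (map (gF G) p)"

abbreviation BB :: "('v, 'e, 'a) gw \<Rightarrow> 'e list \<Rightarrow> 'a list" where
  "BB G p \<equiv> concat (map (gB G) p)"

lemma FF_filter: "concat (map (gfw G) (filter (\<lambda>e. distr G (gsrc G e)) p)) = FF G p"
  by (induction p) (auto simp: gF_def)

lemma BB_filter: "concat (map (gbw G) (filter (\<lambda>e. coll G (gtgt G e)) p)) = BB G p"
  by (induction p) (auto simp: gB_def)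

lemma Fw_Cons: "Fw G (e # p) = gfw G e @ FF G p"
  by (simp add: Fw_def FF_filter)

lemma Bw_snoc: "Bw G (p @ [e]) = BB G p @ gbw G e"
  by (simp add: Bw_def BB_filter)

lemma Fw_append: "p \<noteq> [] \<Longrightarrow> Fw G (p @ q) = Fw G p @ FF G q"
  by (cases p) (auto simp: Fw_Cons)

lemma Bw_append: "q \<noteq> [] \<Longrightarrow> Bw G (p @ q) = BB G p @ Bw G q"
  by (cases q rule: rev_cases) (auto simp: Bw_snoc simp flip: append_assoc)

lemma Fw_FF: "p \<noteq> [] \<Longrightarrow> distr G (gsrc G (hd p)) \<Longrightarrow> Fw G p = FF G p"
  by (cases p) (auto simp: Fw_Cons gF_def)

lemma Bw_BB: "p \<noteq> [] \<Longrightarrow> coll G (gtgt G (last p)) \<Longrightarrow> Bw G p = BB G p"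
  by (cases p rule: rev_cases) (auto simp: Bw_snoc gB_def)

lemma symmetric_path_is_path: "symmetric_path G s \<Longrightarrow> is_path G s"
  by (simp add: symmetric_path_def)

lemma symmetric_path_nonempty: "symmetric_path G s \<Longrightarrow> s \<noteq> []"
  by (simp add: symmetric_path_def is_path_def)

text \<open>Up to the end of \<open>s\<close> the word can be read backwards, by
  \<open>F = B\<close> for \<open>l @ s\<close>, so \<open>l\<close> contributes back words; beyond
  \<open>s\<close> it is read forwards. Symmetry of \<open>s\<close> turns its back word into
  \<open>Fw G s\<close>.\<close>

lemma Fw_symmetric_infix:
  assumes FB: "\<And>s. symmetric_path G s \<Longrightarrow> Fw G s = Bw G s"
    and sym: "symmetric_path G (l @ s @ r)" "symmetric_path G s"
  shows "Fw G (l @ s @ r) = BB G l @ Fw G s @ FF G r"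
proof -
  have ne: "s \<noteq> []" using sym by (auto simp: symmetric_path_def is_path_def)
  have "symmetric_path G (l @ s)"
    using sym is_path_infix[of G "[]" "l @ s" r] ne
    by (cases l) (auto simp: symmetric_path_def)
  hence "Fw G (l @ s) = BB G l @ Fw G s"
    using FB[of "l @ s"] FB[OF sym(2)] Bw_append[OF ne, of G l] by simp
  thus ?thesis using Fw_append[of "l @ s" G r] ne by simp
qed

text \<open>Cutting in front of the last non-initial edge that starts at a distributing vertex
  removes exactly one front word, because the edges after it contribute nothing, and the remainder
  is again symmetric. Steps of size at most \<open>M\<close> cannot jump over the window from
  \<open>n\<close> to \<open>n + M\<close>.\<close>

lemma symmetric_prefix_cut:
  assumes M: "\<And>e. e \<in> gedges G \<Longrightarrow> length (gfw G e) \<le> M"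
    and "symmetric_path G t" "n \<le> length (Fw G t)"
  shows "\<exists>s r. t = s @ r \<and> symmetric_path G s \<and> n \<le> length (Fw G s) \<and> length (Fw G s) \<le> n + M"
  using assms(2,3)
proof (induction t rule: length_induct)
  case (1 t)
  note path = symmetric_path_is_path[OF "1.prems"(1)]
  show ?case
  proof (cases "length (Fw G t) \<le> n + M")
    case True
    thus ?thesis using "1.prems" by (intro exI[of _ t] exI[of _ "[]"]) auto
  next
    case False
    obtain e p where t: "t = e # p" using path by (cases t) (auto simp: is_path_def)
    have eM: "length (gfw G e) \<le> M" using M path t by (auto simp: is_path_Cons)
    \<comment> \<open>Otherwise the word would be a single front word, of length at most
      \<open>M\<close>, and no cut would be required.\<close>
    have "\<exists>f\<in>set p. distr G (gsrc G f)"
    proof (rule ccontr)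
      assume "\<not> ?thesis"
      hence "Fw G t = gfw G e" by (auto simp: gF_def t Fw_Cons)
      thus False using False eM by simp
    qed
    then obtain p1 f p2 where p: "p = p1 @ f # p2" "distr G (gsrc G f)"
      "\<forall>z\<in>set p2. \<not> distr G (gsrc G z)"
      using split_list_last_prop[of p "\<lambda>f. distr G (gsrc G f)"] by blast
    let ?t = "e # p1"
    have "FF G p2 = []" using p(3) by (auto simp: gF_def)
    hence F: "Fw G t = Fw G ?t @ gfw G f" using p(2) by (simp add: t p(1) Fw_Cons gF_def)
    have fM: "length (gfw G f) \<le> M" using M path t p(1) by (auto simp: is_path_def)
    have "is_path G (?t @ f # p2)" using path t p(1) by simp
    hence "is_path G ?t" "gtgt G (last ?t) = gsrc G f"
      using is_path_append[of ?t "f # p2" G] by auto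
    hence "symmetric_path G ?t" using "1.prems"(1) p(2) by (auto simp: symmetric_path_def t)
    moreover have "n \<le> length (Fw G ?t)" using F False fM by simp
    moreover have "length ?t < length t" by (simp add: t p(1))
    ultimately obtain s r where "?t = s @ r" "symmetric_path G s" "n \<le> length (Fw G s)" "length (Fw G s) \<le> n + M"
      using "1.IH" by blast
    moreover have "t = ?t @ f # p2" by (simp add: t p(1))
    ultimately show ?thesis by (metis append_assoc)
  qed
qed

text \<open>Mirror image of \<open>symmetric_prefix_cut\<close>: the cut is behind the first
  non-final edge that ends at a collecting vertex.\<close>

lemma symmetric_suffix_cut:
  assumes M: "\<And>e. e \<in> gedges G \<Longrightarrow> length (gbw G e) \<le> M"
    and "symmetric_path G t" "n \<le> length (Bw G t)"
  shows "\<exists>l s. t = l @ s \<and> symmetric_path G s \<and> n \<le> length (Bw G s) \<and> length (Bw G s) \<le> n + M"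
  using assms(2,3)
proof (induction t rule: length_induct)
  case (1 t)
  note path = symmetric_path_is_path[OF "1.prems"(1)]
  show ?case
  proof (cases "length (Bw G t) \<le> n + M")
    case True
    thus ?thesis using "1.prems" by (intro exI[of _ "[]"] exI[of _ t]) auto
  next
    case False
    obtain e p where t: "t = p @ [e]" using path by (cases t rule: rev_cases) (auto simp: is_path_def)
    have eM: "length (gbw G e) \<le> M" using M path t by (auto simp: is_path_def)
    have "\<exists>f\<in>set p. coll G (gtgt G f)"
    proof (rule ccontr)
      assume "\<not> ?thesis"
      hence "Bw G t = gbw G e" by (auto simp: gB_def t Bw_snoc)
      thus False using False eM by simp
    qed
    then obtain p1 f p2 where p: "p = p1 @ f # p2" "coll G (gtgt G f)"
      "\<forall>z\<in>set p1. \<not> coll G (gtgt G z)"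
      using split_list_first_prop[of p "\<lambda>f. coll G (gtgt G f)"] by blast
    let ?t = "p2 @ [e]"
    have "BB G p1 = []" using p(3) by (auto simp: gB_def)
    hence F: "Bw G t = gbw G f @ Bw G ?t" using p(2) by (simp add: t p(1) Bw_snoc gB_def flip: append_assoc)
    have fM: "length (gbw G f) \<le> M" using M path t p(1) by (auto simp: is_path_def)
    have "is_path G ((p1 @ [f]) @ ?t)" using path t p(1) by simp
    hence "is_path G ?t" "gtgt G f = gsrc G (hd ?t)"
      using is_path_append[of "p1 @ [f]" ?t G] by auto
    hence "symmetric_path G ?t" using "1.prems"(1) p(2) by (auto simp: symmetric_path_def t)
    moreover have "n \<le> length (Bw G ?t)" using F False fM by simp
    moreover have "length ?t < length t" by (simp add: t p(1))
    ultimately obtain l s where "?t = l @ s" "symmetric_path G s" "n \<le> length (Bw G s)" "length (Bw G s) \<le> n + M"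
      using "1.IH" by blast
    moreover have "t = (p1 @ [f]) @ ?t" by (simp add: t p(1))
    ultimately show ?thesis by (metis append_assoc)
  qed
qed

section \<open>Rauzy schemes\<close>

locale rauzy =
  fixes G :: "('v, 'e, 'a) gw" and W :: "nat \<Rightarrow> 'a"
  assumes rec: "recurrent W" and scheme: "rauzy_scheme G W"
begin

lemma finite_edges: "finite (gedges G)"
  and src_vert: "e \<in> gedges G \<Longrightarrow> gsrc G e \<in> gverts G"
  and tgt_vert: "e \<in> gedges G \<Longrightarrow> gtgt G e \<in> gverts G"
  and finite_verts: "finite (gverts G)"
  and distr_or_coll: "u \<in> gverts G \<Longrightarrow> distr G u \<or> coll G u"
  and Fw_eq_Bw: "symmetric_path G s \<Longrightarrow> Fw G s = Bw G s"
  using scheme by (auto simp: rauzy_scheme_def graph_with_words_def well_formed_def)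

lemma fw_distinct: "distr G (gsrc G e) \<Longrightarrow> e \<in> gedges G \<Longrightarrow> f \<in> gedges G \<Longrightarrow> gsrc G f = gsrc G e \<Longrightarrow> e \<noteq> f \<Longrightarrow>
    gfw G e \<noteq> [] \<and> gfw G f \<noteq> [] \<and> hd (gfw G e) \<noteq> hd (gfw G f)"
  and bw_distinct: "coll G (gtgt G e) \<Longrightarrow> e \<in> gedges G \<Longrightarrow> f \<in> gedges G \<Longrightarrow> gtgt G f = gtgt G e \<Longrightarrow> e \<noteq> f \<Longrightarrow>
    gbw G e \<noteq> [] \<and> gbw G f \<noteq> [] \<and> last (gbw G e) \<noteq> last (gbw G f)"
  using scheme src_vert[of e] tgt_vert[of e] unfolding rauzy_scheme_def by metis+

lemma occ_Fw_le:
  assumes "symmetric_path G s1" "symmetric_path G s2"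
  shows "occ (Fw G s1) (Fw G s2) \<le> occ s1 s2"
proof (cases "occ (Fw G s1) (Fw G s2) = 0")
  case False
  thus ?thesis using scheme assms unfolding rauzy_scheme_def by (metis One_nat_def Suc_leI le_refl neq0_conv)
qed simp

lemma factor_covered: "factor u W \<Longrightarrow> \<exists>s. symmetric_path G s \<and> sublist u (Fw G s)"
  using scheme unfolding rauzy_scheme_def lfactor_sublist by blast

lemma edge_marker: "e \<in> gedges G \<Longrightarrow> \<exists>u. factor u W \<and> (\<forall>s. symmetric_path G s \<and> sublist u (Fw G s) \<longrightarrow> e \<in> set s)"
  using scheme unfolding rauzy_scheme_def lfactor_sublist by blast

lemma gfw_nonempty:
  assumes "e \<in> gedges G" "distr G (gsrc G e)" shows "gfw G e \<noteq> []"
proof -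
  have "1 < card {f \<in> gedges G. gsrc G f = gsrc G e}" using assms by (simp add: distr_def outdeg_def)
  then obtain f where "f \<in> gedges G" "gsrc G f = gsrc G e" "f \<noteq> e"
    using assms(1) by (metis (mono_tags, lifting) card_le_Suc0_iff_eq finite_edges finite_subset mem_Collect_eq not_less One_nat_def subsetI)
  thus ?thesis using fw_distinct assms by metis
qed

lemma gbw_nonempty:
  assumes "e \<in> gedges G" "coll G (gtgt G e)" shows "gbw G e \<noteq> []"
proof -
  have "1 < card {f \<in> gedges G. gtgt G f = gtgt G e}" using assms by (simp add: coll_def indeg_def)
  then obtain f where "f \<in> gedges G" "gtgt G f = gtgt G e" "f \<noteq> e"
    using assms(1) by (metis (mono_tags, lifting) card_le_Suc0_iff_eq finite_edges finite_subset mem_Collect_eq not_less One_nat_def subsetI)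
  thus ?thesis using bw_distinct assms by metis
qed

lemma symmetric_infix:
  "symmetric_path G (l @ s @ r) \<Longrightarrow> symmetric_path G s \<Longrightarrow> Fw G (l @ s @ r) = BB G l @ Fw G s @ FF G r"
  using Fw_symmetric_infix Fw_eq_Bw by metis

text \<open>Distinct path occurrences give distinct word occurrences, because back words of edges
  entering a collecting vertex are nonempty; condition (4) then makes the correspondence bijective.\<close>

lemma occurrence_synchronized:
  assumes sym: "symmetric_path G s1" "symmetric_path G s2" and F: "Fw G s2 = a @ Fw G s1 @ b"
  obtains l r where "s2 = l @ s1 @ r" "a = BB G l" "b = FF G r"
proof -
  let ?I = "{i. \<exists>l r. s2 = l @ s1 @ r \<and> length l = i}"
  let ?J = "{i. \<exists>a b. Fw G s2 = a @ Fw G s1 @ b \<and> length a = i}"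
  let ?f = "\<lambda>i. length (BB G (take i s2))"
  have ne: "s1 \<noteq> []" using symmetric_path_nonempty sym by blast
  have sub: "?f ` ?I \<subseteq> ?J"
  proof safe
    fix l r assume s2: "s2 = l @ s1 @ r"
    have "Fw G s2 = BB G l @ Fw G s1 @ FF G r" using symmetric_infix[of l s1 r] sym s2 by simp
    thus "\<exists>a b. Fw G (l @ s1 @ r) = a @ Fw G s1 @ b \<and> length a = length (BB G (take (length l) (l @ s1 @ r)))"
      by (intro exI[of _ "BB G l"] exI[of _ "FF G r"]) (simp add: s2)
  qed
  have less: "?f i < ?f j" if ij: "i \<in> ?I" "j \<in> ?I" "i < j" for i j
  proof -
    obtain l r where j: "s2 = l @ s1 @ r" "length l = j" using ij(2) by blast
    have lne: "l \<noteq> []" using j(2) ij(3) by auto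
    hence path: "is_path G l" "gtgt G (last l) = gsrc G (hd s1)"
      using is_path_append[of l "s1 @ r" G] ne j(1) symmetric_path_is_path[OF sym(2)] by auto
    have coll: "coll G (gtgt G (last l))" using path sym(1) by (simp add: symmetric_path_def)
    obtain l' e where l': "l = l' @ [e]" using lne by (cases l rule: rev_cases) auto
    have "e \<in> gedges G" using path(1) l' by (simp add: is_path_def)
    hence "gbw G e \<noteq> []" using gbw_nonempty coll l' by simp
    hence gt: "length (BB G l') < length (BB G l)" using coll by (simp add: l' gB_def)
    have "take i s2 = take i l'" using ij(3) j(2) by (simp add: j(1) l')
    moreover have "BB G l' = BB G (take i l') @ BB G (drop i l')" by (simp flip: concat_append map_append)
    ultimately have "?f i \<le> length (BB G l')" by simp
    thus ?thesis using gt j by simp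
  qed
  have "inj_on ?f ?I"
    by (rule inj_onI, rule ccontr, erule linorder_neqE_nat) (drule (2) less, linarith)+
  hence "card (?f ` ?I) = occ s1 s2" by (simp add: card_image occ_alt)
  hence "card ?J \<le> card (?f ` ?I)" using occ_Fw_le[OF sym] by (simp add: occ_alt)
  hence "?f ` ?I = ?J" using card_seteq[OF finite_occ sub] by simp
  moreover have "length a \<in> ?J" using F by blast
  ultimately have "length a \<in> ?f ` ?I" by (simp only:)
  then obtain i where i: "length a = ?f i" "i \<in> ?I" by (rule imageE)
  then obtain l r where "s2 = l @ s1 @ r" "length l = i" by blast
  hence s2: "s2 = l @ s1 @ r" "length a = length (BB G l)" using i(1) by simp_all
  have "Fw G s2 = BB G l @ Fw G s1 @ FF G r" using symmetric_infix[of l s1 r] sym s2 by simp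
  thus ?thesis using that s2 F by simp
qed

section \<open>Trimming symmetric paths until their words are factors of \<open>W\<close>\<close>

lemma words_bounded:
  obtains M where "\<And>e. e \<in> gedges G \<Longrightarrow> length (gfw G e) \<le> M" "\<And>e. e \<in> gedges G \<Longrightarrow> length (gbw G e) \<le> M"
proof
  let ?M = "(\<Sum>e\<in>gedges G. length (gfw G e) + length (gbw G e))"
  fix e assume e: "e \<in> gedges G"
  have "length (gfw G e) + length (gbw G e) \<le> ?M"
    using member_le_sum[OF e, of "\<lambda>e. length (gfw G e) + length (gbw G e)"] finite_edges by simp
  thus "length (gfw G e) \<le> ?M" "length (gbw G e) \<le> ?M" by auto
qed

text \<open>A path covering a long window of \<open>W\<close> may read letters outside
  \<open>W\<close> at both sides. Cutting it right and left leaves at most \<open>M\<close> letters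
  beyond the essential part, all inside the margins, so the trimmed word is itself a factor. The
  ends \<open>t1\<close> and \<open>t2\<close> are cut out separately so that whatever
  \<open>u\<close> and \<open>x\<close> mark lies in disjoint stretches in the prescribed
  order.\<close>

lemma symmetric_path_through:
  assumes "factor u W" "factor w W" "factor x W"
  obtains t1 q t2 where "symmetric_path G (t1 @ q @ t2)" "symmetric_path G t1" "symmetric_path G t2"
    "sublist u (Fw G t1)" "sublist x (Fw G t2)" "sublist w (Fw G (t1 @ q @ t2))"
    "factor (Fw G (t1 @ q @ t2)) W"
proof -
  obtain M where M: "\<And>e. e \<in> gedges G \<Longrightarrow> length (gfw G e) \<le> M" "\<And>e. e \<in> gedges G \<Longrightarrow> length (gbw G e) \<le> M"
    using words_bounded by blast
  \<comment> \<open>Each margin absorbs one cut of cost \<open>M\<close>. The gap must exceed the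
    excess of \<open>t1\<close> to the right of \<open>u\<close> plus that of \<open>t2\<close> to
    the left of \<open>x\<close>, whence \<open>2 * M + 1\<close>.\<close>
  obtain a m n c where win: "factor (a @ u @ m @ w @ n @ x @ c) W"
    "length a = M" "length c = M" "2 * M + 1 \<le> length n"
    using recurrent_window[OF rec assms] by metis
  let ?mid = "u @ m @ w @ n @ x"
  obtain s0 where s0: "symmetric_path G s0" "sublist (a @ u @ m @ w @ n @ x @ c) (Fw G s0)"
    using factor_covered[OF win(1)] by blast
  then obtain A B where AB: "Fw G s0 = A @ (a @ u @ m @ w @ n @ x @ c) @ B" by (auto simp: sublist_def)
  have "length (A @ a @ ?mid) \<le> length (Fw G s0)" using AB by simp
  then obtain s1 r where s1: "s0 = s1 @ r" "symmetric_path G s1" "length (A @ a @ ?mid) \<le> length (Fw G s1)"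
     "length (Fw G s1) \<le> length (A @ a @ ?mid) + M"
    using symmetric_prefix_cut[OF M(1) s0(1)] by blast
  have "Fw G s0 = Fw G s1 @ FF G r" using s1(1) Fw_append symmetric_path_nonempty[OF s1(2)] by simp
  hence "(A @ a @ ?mid) @ (c @ B) = Fw G s1 @ FF G r" using AB by simp
  then obtain c' where c': "Fw G s1 = (A @ a @ ?mid) @ c'" "c @ B = c' @ FF G r"
    using s1(3) by (rule append_cut_prefix)
  have "length c' \<le> M" using s1(4) c'(1) by simp
  then obtain c'' where c'': "c = c' @ c''" using append_cut_prefix[OF c'(2)[symmetric]] win(3) by metis
  have FB1: "Fw G s1 = Bw G s1" using Fw_eq_Bw s1(2) by blast
  have "length (?mid @ c') \<le> length (Bw G s1)" unfolding FB1[symmetric] c'(1) by simp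
  then obtain l s where s: "s1 = l @ s" "symmetric_path G s" "length (?mid @ c') \<le> length (Bw G s)"
    "length (Bw G s) \<le> length (?mid @ c') + M"
    using symmetric_suffix_cut[OF M(2) s1(2)] by blast
  note FBs = Fw_eq_Bw[OF s(2)]
  have "Bw G s1 = BB G l @ Fw G s" using s(1) Bw_append symmetric_path_nonempty[OF s(2)] FBs by simp
  hence "(A @ a) @ (?mid @ c') = BB G l @ Fw G s" using FB1 c' by simp
  then obtain a' where a': "Fw G s = a' @ ?mid @ c'" "A @ a = BB G l @ a'"
    using append_cut_suffix s(3) FBs by metis
  have "length a' \<le> M" using s(4) unfolding FBs[symmetric] a'(1) by simp
  then obtain a'' where a'': "a = a'' @ a'" using append_cut_suffix[OF a'(2)[symmetric]] win(2) by metis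
  have fac: "factor (Fw G s) W"
    by (rule factor_mono[OF win(1)], unfold sublist_def a'(1) a'' c'',
        intro exI[of _ a''] exI[of _ c'']) simp
  have "length (a' @ u) \<le> length (Fw G s)" using a' by simp
  then obtain t1 r1 where t1: "s = t1 @ r1" "symmetric_path G t1" "length (a' @ u) \<le> length (Fw G t1)"
    "length (Fw G t1) \<le> length (a' @ u) + M"
    using symmetric_prefix_cut[OF M(1) s(2)] by blast
  have "Fw G s = Fw G t1 @ FF G r1" using t1(1) Fw_append symmetric_path_nonempty[OF t1(2)] by simp
  hence "(a' @ u) @ (m @ w @ n @ x @ c') = Fw G t1 @ FF G r1" using a' by simp
  then obtain m' where m': "Fw G t1 = a' @ u @ m'"
    using t1(3) append_cut_prefix append_assoc by metis
  have "length (x @ c') \<le> length (Bw G s)" using a' FBs by simp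
  then obtain l2 t2 where t2: "s = l2 @ t2" "symmetric_path G t2" "length (x @ c') \<le> length (Bw G t2)"
    "length (Bw G t2) \<le> length (x @ c') + M"
    using symmetric_suffix_cut[OF M(2) s(2)] by blast
  note FB2 = Fw_eq_Bw[OF t2(2)]
  have Bs: "Bw G s = BB G l2 @ Fw G t2" using t2(1) Bw_append symmetric_path_nonempty[OF t2(2)] FB2 by simp
  hence eq2: "(a' @ u @ m @ w @ n) @ (x @ c') = BB G l2 @ Fw G t2" using a' FBs by simp
  then obtain n' where n': "Fw G t2 = n' @ x @ c'"
    using t2(3) FB2 append_cut_suffix by metis
  have len: "length (Fw G t1) < length (BB G l2)"
    using arg_cong[OF eq2, of length] t2(4) FB2 t1(4) win(4) by simp
  \<comment> \<open>If \<open>t1\<close> reached beyond \<open>l2\<close>, its word, read backwards,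
    would begin with all of \<open>BB G l2\<close>, which is already longer.\<close>
  have "length t1 \<le> length l2"
  proof (rule ccontr)
    assume "\<not> ?thesis"
    then obtain z where z: "t1 = l2 @ z" "z \<noteq> []"
      using append_cut_prefix[of l2 t2 t1 r1] t1(1) t2(1) by (metis append_Nil2 le_refl nat_le_linear)
    hence "Fw G t1 = BB G l2 @ Bw G z" using Fw_eq_Bw[OF t1(2)] Bw_append by metis
    thus False using len by simp
  qed
  then obtain q where q: "l2 = t1 @ q" using t1(1) t2(1) append_cut_prefix[of t1 r1 l2 t2] by metis
  have sq: "s = t1 @ q @ t2" using t2(1) q by simp
  show ?thesis
  proof (rule that[of t1 q t2])
    show "sublist w (Fw G (t1 @ q @ t2))"
      unfolding sq[symmetric] a'(1) sublist_def
      by (intro exI[of _ "a' @ u @ m"] exI[of _ "n @ x @ c'"]) simp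
    show "sublist x (Fw G t2)" unfolding n' by auto
    show "sublist u (Fw G t1)" unfolding m' by auto
  qed (use s(2) fac t1(2) t2(2) in \<open>simp_all add: sq\<close>)
qed

end

section \<open>The graph $S'$\<close>

lemma coll_out_unique:
  assumes "coll G u" "e \<in> gedges G" "f \<in> gedges G" "gsrc G e = u" "gsrc G f = u"
  shows "e = f"
proof -
  have "card {e \<in> gedges G. gsrc G e = u} = 1" using assms(1) by (simp add: coll_def outdeg_def)
  then obtain g where "{e \<in> gedges G. gsrc G e = u} = {g}" by (rule card_1_singletonE)
  thus ?thesis using assms(2-) by (metis (mono_tags, lifting) mem_Collect_eq singletonD)
qed

lemma distr_in_unique:
  assumes "distr G u" "e \<in> gedges G" "f \<in> gedges G" "gtgt G e = u" "gtgt G f = u"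
  shows "e = f"
proof -
  have "card {e \<in> gedges G. gtgt G e = u} = 1" using assms(1) by (simp add: distr_def indeg_def)
  then obtain g where "{e \<in> gedges G. gtgt G e = u} = {g}" by (rule card_1_singletonE)
  thus ?thesis using assms(2-) by (metis (mono_tags, lifting) mem_Collect_eq singletonD)
qed

locale evolution = rauzy S W for S :: "('v, 'e, 'a) gw" and W :: "nat \<Rightarrow> 'a" +
  fixes v :: 'e
  assumes support: "support_edge S v"
begin

abbreviation S' where "S' \<equiv> S1 S v"

lemma v_edge: "v \<in> gedges S" and v_src: "coll S (gsrc S v)" and v_tgt: "distr S (gtgt S v)"
  using support by (auto simp: support_edge_def)

lemma v_src_ne_tgt: "gsrc S v \<noteq> gtgt S v"
  using v_src v_tgt not_distr_coll by metis

lemma src_eq_v: "e \<in> gedges S \<Longrightarrow> gsrc S e = gsrc S v \<longleftrightarrow> e = v"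
  using coll_out_unique[OF v_src] v_edge by blast

lemma tgt_eq_v: "e \<in> gedges S \<Longrightarrow> gtgt S e = gtgt S v \<longleftrightarrow> e = v"
  using distr_in_unique[OF v_tgt] v_edge by blast

lemma finite_xs: "finite (xs_in S v)" and finite_ys: "finite (ys_out S v)"
  using finite_edges by (auto simp: xs_in_def ys_out_def)

lemma card_xs: "1 < card (xs_in S v)" and card_ys: "1 < card (ys_out S v)"
  using v_src v_tgt by (auto simp: xs_in_def ys_out_def coll_def distr_def indeg_def outdeg_def)

lemma xs_iff: "x \<in> xs_in S v \<longleftrightarrow> x \<in> gedges S \<and> x \<noteq> v \<and> gtgt S x = gsrc S v"
  using v_src_ne_tgt by (auto simp: xs_in_def)

lemma ys_iff: "y \<in> ys_out S v \<longleftrightarrow> y \<in> gedges S \<and> y \<noteq> v \<and> gsrc S y = gtgt S v"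
  using v_src_ne_tgt by (auto simp: ys_out_def)

lemma S1_simps [simp]:
  "gsrc S' (OldE e) = (if gsrc S e = gtgt S v then OutB e else Old (gsrc S e))"
  "gsrc S' (New x y) = InA x"
  "gtgt S' (OldE e) = (if gtgt S e = gsrc S v then InA e else Old (gtgt S e))"
  "gtgt S' (New x y) = OutB y"
  "gfw S' (OldE e) = (if gsrc S e = gtgt S v then gfw S v @ gfw S e else gfw S e)"
  "gfw S' (New x y) = gfw S y"
  "gbw S' (OldE e) = (if gtgt S e = gsrc S v then gbw S e @ gfw S v else gbw S e)"
  "gbw S' (New x y) = gbw S x"
  "OldE e \<in> gedges S' \<longleftrightarrow> e \<in> gedges S \<and> e \<noteq> v"
  "New x y \<in> gedges S' \<longleftrightarrow> x \<in> xs_in S v \<and> y \<in> ys_out S v"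
  by (auto simp: S1_def)

lemma finite_S1_edges: "finite (gedges S')"
proof -
  have "gedges S' = OldE ` (gedges S - {v}) \<union> (\<lambda>(x, y). New x y) ` (xs_in S v \<times> ys_out S v)"
    by (auto simp: S1_def)
  thus ?thesis using finite_edges finite_xs finite_ys by simp
qed

lemma finite_S1_verts: "finite (gverts S')"
  using finite_verts finite_xs finite_ys by (simp add: S1_def)

lemma S1_src_vert: "\<epsilon> \<in> gedges S' \<Longrightarrow> gsrc S' \<epsilon> \<in> gverts S'"
  by (cases \<epsilon>) (auto simp: xs_iff ys_iff src_vert src_eq_v, auto simp: S1_def xs_iff ys_iff src_vert src_eq_v)

lemma S1_tgt_vert: "\<epsilon> \<in> gedges S' \<Longrightarrow> gtgt S' \<epsilon> \<in> gverts S'"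
  by (cases \<epsilon>) (auto simp: xs_iff ys_iff tgt_vert tgt_eq_v, auto simp: S1_def xs_iff ys_iff tgt_vert tgt_eq_v)

lemma S1_in_Old: "u \<notin> {gsrc S v, gtgt S v} \<Longrightarrow>
    {\<epsilon> \<in> gedges S'. gtgt S' \<epsilon> = Old u} = OldE ` {e \<in> gedges S. gtgt S e = u}"
  by (auto simp: S1_def split: if_splits)

lemma S1_out_Old: "u \<notin> {gsrc S v, gtgt S v} \<Longrightarrow>
    {\<epsilon> \<in> gedges S'. gsrc S' \<epsilon> = Old u} = OldE ` {e \<in> gedges S. gsrc S e = u}"
  by (auto simp: S1_def split: if_splits)

lemma S1_in_InA: "x \<in> xs_in S v \<Longrightarrow> {\<epsilon> \<in> gedges S'. gtgt S' \<epsilon> = InA x} = {OldE x}"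
  by (auto simp: S1_def xs_iff split: if_splits)

lemma S1_out_InA: "x \<in> xs_in S v \<Longrightarrow> {\<epsilon> \<in> gedges S'. gsrc S' \<epsilon> = InA x} = New x ` ys_out S v"
  by (auto simp: S1_def split: if_splits)

lemma S1_in_OutB: "y \<in> ys_out S v \<Longrightarrow> {\<epsilon> \<in> gedges S'. gtgt S' \<epsilon> = OutB y} = (\<lambda>x. New x y) ` xs_in S v"
  by (auto simp: S1_def split: if_splits)

lemma S1_out_OutB: "y \<in> ys_out S v \<Longrightarrow> {\<epsilon> \<in> gedges S'. gsrc S' \<epsilon> = OutB y} = {OldE y}"
  by (auto simp: S1_def ys_iff split: if_splits)

lemma S1_Old:
  assumes "u \<notin> {gsrc S v, gtgt S v}"
  shows "distr S' (Old u) \<longleftrightarrow> distr S u" "coll S' (Old u) \<longleftrightarrow> coll S u"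
  unfolding distr_def coll_def indeg_def outdeg_def S1_in_Old[OF assms] S1_out_Old[OF assms]
  by (simp_all add: card_image inj_on_def)

lemma S1_InA: "x \<in> xs_in S v \<Longrightarrow> distr S' (InA x)"
  unfolding distr_def indeg_def outdeg_def using card_ys
  by (simp add: card_image inj_on_def S1_in_InA S1_out_InA)

lemma S1_OutB: "y \<in> ys_out S v \<Longrightarrow> coll S' (OutB y)"
  unfolding coll_def indeg_def outdeg_def using card_xs
  by (simp add: card_image inj_on_def S1_in_OutB S1_out_OutB)

lemma S1_distr_or_coll:
  assumes "u \<in> gverts S'" shows "distr S' u \<or> coll S' u"
proof (cases u)
  case (Old a)
  hence "a \<in> gverts S" "a \<notin> {gsrc S v, gtgt S v}" using assms by (auto simp: S1_def)
  thus ?thesis using distr_or_coll S1_Old Old by metis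
next
  case (InA x)
  thus ?thesis using assms S1_InA by (auto simp: S1_def)
next
  case (OutB y)
  thus ?thesis using assms S1_OutB by (auto simp: S1_def)
qed

text \<open>Splitting exchanges the kinds at the ends of \<open>v\<close>: \<open>y_j\<close> now
  leaves the collecting vertex \<open>B_j\<close> and \<open>x_i\<close> enters the distributing
  vertex \<open>A_i\<close>, so their words no longer count in the interior of a path. The edges
  \<open>v_ij\<close> take over.\<close>

lemma S1_endpoint_kinds:
  assumes "e \<in> gedges S" "e \<noteq> v"
  shows "distr S' (gsrc S' (OldE e)) \<longleftrightarrow> distr S (gsrc S e) \<and> gsrc S e \<noteq> gtgt S v"
    "coll S' (gsrc S' (OldE e)) \<longleftrightarrow> coll S (gsrc S e) \<or> gsrc S e = gtgt S v"
    "distr S' (gtgt S' (OldE e)) \<longleftrightarrow> distr S (gtgt S e) \<or> gtgt S e = gsrc S v"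
    "coll S' (gtgt S' (OldE e)) \<longleftrightarrow> coll S (gtgt S e) \<and> gtgt S e \<noteq> gsrc S v"
proof -
  have "gsrc S e \<noteq> gsrc S v" "gtgt S e \<noteq> gtgt S v" using assms src_eq_v tgt_eq_v by auto
  moreover have "gsrc S e = gtgt S v \<Longrightarrow> coll S' (OutB e)" using S1_OutB ys_iff assms by auto
  moreover have "gtgt S e = gsrc S v \<Longrightarrow> distr S' (InA e)" using S1_InA xs_iff assms by auto
  ultimately show "distr S' (gsrc S' (OldE e)) \<longleftrightarrow> distr S (gsrc S e) \<and> gsrc S e \<noteq> gtgt S v"
    "coll S' (gsrc S' (OldE e)) \<longleftrightarrow> coll S (gsrc S e) \<or> gsrc S e = gtgt S v"
    "distr S' (gtgt S' (OldE e)) \<longleftrightarrow> distr S (gtgt S e) \<or> gtgt S e = gsrc S v"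
    "coll S' (gtgt S' (OldE e)) \<longleftrightarrow> coll S (gtgt S e) \<and> gtgt S e \<noteq> gsrc S v"
    using not_distr_coll[of S' "OutB e"] not_distr_coll[of S' "InA e"]
    by (auto simp: S1_Old)
qed

lemma S1_New_kinds:
  assumes "New x y \<in> gedges S'"
  shows "distr S' (gsrc S' (New x y))" "coll S' (gtgt S' (New x y))"
  using assms S1_InA S1_OutB by auto

text \<open>The edges leaving \<open>A_i\<close> carry the words \<open>Y_j\<close>, which have
  distinct first letters at the end of \<open>v\<close> in S; at the other distributing vertices
  nothing has changed.\<close>

lemma S1_fw_distinct:
  assumes "distr S' (gsrc S' \<epsilon>)" "\<epsilon> \<in> gedges S'" "\<delta> \<in> gedges S'" "gsrc S' \<delta> = gsrc S' \<epsilon>" "\<epsilon> \<noteq> \<delta>"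
  shows "gfw S' \<epsilon> \<noteq> [] \<and> gfw S' \<delta> \<noteq> [] \<and> hd (gfw S' \<epsilon>) \<noteq> hd (gfw S' \<delta>)"
proof (cases \<epsilon>)
  case (OldE e)
  hence e: "distr S (gsrc S e)" "gsrc S e \<noteq> gtgt S v" "e \<in> gedges S" "e \<noteq> v"
    using assms(1,2) S1_endpoint_kinds by auto
  then obtain f where f: "\<delta> = OldE f" "gsrc S f = gsrc S e"
    using assms(4) OldE by (cases \<delta>) (auto split: if_splits)
  show ?thesis using fw_distinct[of e f] e f assms(2,3,5) OldE by auto
next
  case (New x y)
  then obtain y' where y': "\<delta> = New x y'" using assms(4) by (cases \<delta>) (auto split: if_splits)
  show ?thesis using fw_distinct[of y y'] v_tgt y' assms(2,3,5) New by (auto simp: ys_iff)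
qed

lemma S1_bw_distinct:
  assumes "coll S' (gtgt S' \<epsilon>)" "\<epsilon> \<in> gedges S'" "\<delta> \<in> gedges S'" "gtgt S' \<delta> = gtgt S' \<epsilon>" "\<epsilon> \<noteq> \<delta>"
  shows "gbw S' \<epsilon> \<noteq> [] \<and> gbw S' \<delta> \<noteq> [] \<and> last (gbw S' \<epsilon>) \<noteq> last (gbw S' \<delta>)"
proof (cases \<epsilon>)
  case (OldE e)
  hence e: "coll S (gtgt S e)" "gtgt S e \<noteq> gsrc S v" "e \<in> gedges S" "e \<noteq> v"
    using assms(1,2) S1_endpoint_kinds by auto
  then obtain f where f: "\<delta> = OldE f" "gtgt S f = gtgt S e"
    using assms(4) OldE by (cases \<delta>) (auto split: if_splits)
  show ?thesis using bw_distinct[of e f] e f assms(2,3,5) OldE by auto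
next
  case (New x y)
  then obtain x' where x': "\<delta> = New x' y" using assms(4) by (cases \<delta>) (auto split: if_splits)
  show ?thesis using bw_distinct[of x x'] v_src x' assms(2,3,5) New by (auto simp: xs_iff)
qed

section \<open>Projection of paths from S' to S and comparison of their words\<close>

fun proj :: "'e ex \<Rightarrow> 'e" where
  "proj (OldE e) = e"
| "proj (New x y) = v"

lemma proj_step:
  "\<epsilon> \<in> gedges S' \<Longrightarrow> \<delta> \<in> gedges S' \<Longrightarrow> gtgt S' \<epsilon> = gsrc S' \<delta> \<Longrightarrow> gtgt S (proj \<epsilon>) = gsrc S (proj \<delta>)"
  by (cases \<epsilon>; cases \<delta>) (auto simp: xs_iff ys_iff split: if_splits)

lemma proj_edge: "\<epsilon> \<in> gedges S' \<Longrightarrow> proj \<epsilon> \<in> gedges S"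
  using v_edge by (cases \<epsilon>) auto

lemma proj_path: "is_path S' s \<Longrightarrow> is_path S (map proj s)"
proof (induction s)
  case (Cons \<epsilon> s)
  thus ?case by (cases s) (auto simp: is_path_Cons proj_edge proj_step)
qed (simp add: is_path_def)

lemma gF_v: "gF S v = []" and gB_v: "gB S v = []"
  using v_src v_tgt not_distr_coll[of S] by (auto simp: gF_def gB_def)

lemma gF_S1:
  "OldE e \<in> gedges S' \<Longrightarrow> gF S' (OldE e) = (if gsrc S e = gtgt S v then [] else gF S e)"
  "New x y \<in> gedges S' \<Longrightarrow> gF S' (New x y) = gfw S y"
  unfolding gF_def using S1_endpoint_kinds[of e] S1_New_kinds[of x y] by auto

lemma gB_S1:
  "OldE e \<in> gedges S' \<Longrightarrow> gB S' (OldE e) = (if gtgt S e = gsrc S v then [] else gB S e)"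
  "New x y \<in> gedges S' \<Longrightarrow> gB S' (New x y) = gbw S x"
  unfolding gB_def using S1_endpoint_kinds[of e] S1_New_kinds[of x y] by auto

text \<open>The word of \<open>y\<^sub>j\<close> is read one edge earlier in $S'$ than in $S$ (on \<open>v\<^sub>i\<^sub>j\<close>),
  the word of \<open>x\<^sub>i\<close> one edge later.\<close>

fun carryF :: "'e ex \<Rightarrow> 'a list" where
  "carryF (OldE e) = []"
| "carryF (New x y) = gfw S y"

fun carryB :: "'e ex \<Rightarrow> 'a list" where
  "carryB (OldE e) = []"
| "carryB (New x y) = gbw S x"

lemma carryF_step:
  assumes "\<epsilon> \<in> gedges S'" "\<delta> \<in> gedges S'" "gtgt S' \<epsilon> = gsrc S' \<delta>"
  shows "carryF \<epsilon> @ gF S' \<delta> = gF S (proj \<delta>) @ carryF \<delta>"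
  using assms v_tgt
  by (cases \<epsilon>; cases \<delta>) (auto simp: gF_S1 gF_v xs_iff ys_iff split: if_splits, auto simp: gF_def)

lemma carryB_step:
  assumes "\<epsilon> \<in> gedges S'" "\<delta> \<in> gedges S'" "gtgt S' \<epsilon> = gsrc S' \<delta>"
  shows "gB S' \<epsilon> @ carryB \<delta> = carryB \<epsilon> @ gB S (proj \<epsilon>)"
  using assms v_src
  by (cases \<epsilon>; cases \<delta>) (auto simp: gB_S1 gB_v xs_iff ys_iff split: if_splits, auto simp: gB_def)

text \<open>Telescoping of \<open>carryF_step\<close>: S' is ahead of S by the carry of the edge
  just read. If both end edges are copied from S, the carries are empty and the two readings
  agree.\<close>

lemma carryF_path:
  "is_path S' (\<epsilon> # q) \<Longrightarrow> carryF \<epsilon> @ FF S' q = FF S (map proj q) @ carryF (last (\<epsilon> # q))"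
proof (induction q arbitrary: \<epsilon>)
  case (Cons \<delta> q)
  have 1: "carryF \<epsilon> @ gF S' \<delta> = gF S (proj \<delta>) @ carryF \<delta>"
    using Cons.prems by (intro carryF_step) (auto simp: is_path_Cons)
  have 2: "carryF \<delta> @ FF S' q = FF S (map proj q) @ carryF (last (\<delta> # q))"
    using Cons.prems by (intro Cons.IH) (simp add: is_path_Cons)
  have "carryF \<epsilon> @ FF S' (\<delta> # q) = (carryF \<epsilon> @ gF S' \<delta>) @ FF S' q" by simp
  also have "\<dots> = gF S (proj \<delta>) @ carryF \<delta> @ FF S' q" unfolding 1 by simp
  also have "\<dots> = FF S (map proj (\<delta> # q)) @ carryF (last (\<epsilon> # \<delta> # q))" unfolding 2 by simp
  finally show ?case .
qed simp

lemma carryB_path: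
  "is_path S' (q @ [\<epsilon>]) \<Longrightarrow> BB S' q @ carryB \<epsilon> = carryB (hd (q @ [\<epsilon>])) @ BB S (map proj q)"
proof (induction q arbitrary: \<epsilon> rule: rev_induct)
  case (snoc \<delta> q)
  have path: "is_path S' (q @ [\<delta>])" "gtgt S' \<delta> = gsrc S' \<epsilon>" "\<delta> \<in> gedges S'" "\<epsilon> \<in> gedges S'"
    using is_path_append[of "q @ [\<delta>]" "[\<epsilon>]" S'] snoc.prems by (auto simp: is_path_edge)
  have 1: "gB S' \<delta> @ carryB \<epsilon> = carryB \<delta> @ gB S (proj \<delta>)" using path by (intro carryB_step) auto
  have 2: "BB S' q @ carryB \<delta> = carryB (hd (q @ [\<delta>])) @ BB S (map proj q)" by (rule snoc.IH[OF path(1)])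
  have "BB S' (q @ [\<delta>]) @ carryB \<epsilon> = BB S' q @ gB S' \<delta> @ carryB \<epsilon>" by simp
  also have "\<dots> = (BB S' q @ carryB \<delta>) @ gB S (proj \<delta>)" unfolding 1 by simp
  also have "\<dots> = carryB (hd (q @ [\<delta>])) @ BB S (map proj (q @ [\<delta>]))" unfolding 2 by simp
  finally show ?case by (cases q) auto
qed simp

text \<open>A symmetric path of $S'$ may start at some \<open>B\<^sub>j\<close> or end at some \<open>A\<^sub>i\<close>; the corresponding
  path of $S$ then needs the edge \<open>v\<close> added to be symmetric.\<close>

definition unfold :: "'e ex list \<Rightarrow> 'e list" where
  "unfold s = (if gsrc S (proj (hd s)) = gtgt S v then [v] else []) @ map proj s @
     (if gtgt S (proj (last s)) = gsrc S v then [v] else [])"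

text \<open>An edge \<open>v_ij\<close> starts at a distributing and ends at a collecting vertex, so
  it can be neither the first nor the last edge of a symmetric path; hence the carries vanish at
  both ends.\<close>

lemma symmetric_S1_ends:
  assumes "symmetric_path S' s"
  obtains e f where "e \<in> gedges S" "e \<noteq> v" "hd s = OldE e" "coll S (gsrc S e) \<or> gsrc S e = gtgt S v"
    and "f \<in> gedges S" "f \<noteq> v" "last s = OldE f" "distr S (gtgt S f) \<or> gtgt S f = gsrc S v"
proof -
  have E: "hd s \<in> gedges S'" "last s \<in> gedges S'"
    and k: "coll S' (gsrc S' (hd s))" "distr S' (gtgt S' (last s))"
    using assms by (auto simp: symmetric_path_def is_path_def)
  obtain e where e: "hd s = OldE e"
  proof (cases "hd s")
    case (New x y)
    thus ?thesis using E(1) k(1) S1_New_kinds(1)[of x y] not_distr_coll[of S' "gsrc S' (hd s)"] by simp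
  qed
  obtain f where f: "last s = OldE f"
  proof (cases "last s")
    case (New x y)
    thus ?thesis using E(2) k(2) S1_New_kinds(2)[of x y] not_distr_coll[of S' "gtgt S' (last s)"] by simp
  qed
  show ?thesis
    by (rule that[of e f]) (use E k S1_endpoint_kinds[of e] S1_endpoint_kinds[of f] in \<open>simp_all add: e f del: S1_simps(1,3)\<close>)
qed

text \<open>An initial \<open>y_j\<close> has the front word \<open>V Y_j\<close>, and the
  \<open>v\<close> put in front of it supplies this \<open>V\<close>; a \<open>v\<close> appended at
  the end starts at a collecting vertex and contributes nothing.\<close>

lemma unfold_Fw:
  assumes "symmetric_path S' s"
  shows "Fw S' s = Fw S (unfold s)"
proof -
  obtain e f where e: "e \<in> gedges S" "e \<noteq> v" "hd s = OldE e" "coll S (gsrc S e) \<or> gsrc S e = gtgt S v"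
    and f: "last s = OldE f"
    using symmetric_S1_ends[OF assms] by metis
  obtain q where s: "s = OldE e # q" using e(3) symmetric_path_nonempty[OF assms] by (cases s) auto
  have q: "FF S' q = FF S (map proj q)"
    using carryF_path[of "OldE e" q] f s symmetric_path_is_path[OF assms] by simp
  show ?thesis
  proof (cases "gsrc S e = gtgt S v")
    case True
    hence "gF S e = gfw S e" using v_tgt by (simp add: gF_def)
    thus ?thesis using True by (simp add: unfold_def s Fw_Cons q gF_v)
  qed (simp add: unfold_def s Fw_Cons q gF_v)
qed

lemma unfold_path:
  assumes "symmetric_path S' s"
  shows "symmetric_path S (unfold s)"
proof -
  obtain e f where e: "e \<in> gedges S" "e \<noteq> v" "hd s = OldE e" "coll S (gsrc S e) \<or> gsrc S e = gtgt S v"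
    and f: "f \<in> gedges S" "f \<noteq> v" "last s = OldE f" "distr S (gtgt S f) \<or> gtgt S f = gsrc S v"
    using symmetric_S1_ends[OF assms] by metis
  have ne: "s \<noteq> []" using symmetric_path_nonempty[OF assms] .
  have p: "is_path S (map proj s)" using proj_path symmetric_path_is_path[OF assms] by blast
  have pre: "is_path S (v # map proj s)" if "gsrc S e = gtgt S v"
    using p that ne e(3) v_edge by (auto simp: is_path_Cons hd_map)
  have post: "is_path S (q @ [v])" if "gtgt S f = gsrc S v" "is_path S q" "last q = f" for q
    using that v_edge is_path_nonempty[OF that(2)] by (simp add: is_path_append is_path_single)
  have "is_path S (unfold s)" using p ne e(3) f(3) pre post[of "map proj s"] post[of "v # map proj s"]
    by (auto simp: unfold_def last_map)
  moreover have "coll S (gsrc S (hd (unfold s)))"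
    using e(3,4) ne v_src by (auto simp: unfold_def hd_append hd_map)
  moreover have "distr S (gtgt S (last (unfold s)))"
    using f(3,4) ne v_tgt by (auto simp: unfold_def last_append last_map)
  ultimately show ?thesis by (simp add: symmetric_path_def)
qed

text \<open>Condition (3) for the one-edge path \<open>[v]\<close> identifies its two words as the
  common \<open>V\<close>. The back words in \<open>S1\<close> are written with the front word of
  \<open>v\<close>, so comparing \<open>Bw\<close> in S' and S relies on this.\<close>

lemma v_word: "symmetric_path S [v]" "Fw S [v] = gfw S v" "Bw S [v] = gbw S v" "gbw S v = gfw S v"
proof -
  show s: "symmetric_path S [v]" using v_edge v_src v_tgt by (simp add: symmetric_path_def is_path_single)
  show F: "Fw S [v] = gfw S v" "Bw S [v] = gbw S v" by (simp_all add: Fw_def Bw_def)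
  show "gbw S v = gfw S v" using F Fw_eq_Bw[OF s] by simp
qed

lemma unfold_Bw:
  assumes "symmetric_path S' s"
  shows "Bw S' s = Bw S (unfold s)"
proof -
  obtain e f where e: "hd s = OldE e" and f: "last s = OldE f"
    using symmetric_S1_ends[OF assms] by metis
  obtain q where s: "s = q @ [OldE f]" using f symmetric_path_nonempty[OF assms]
    by (cases s rule: rev_cases) auto
  have "BB S' q @ carryB (OldE f) = carryB (hd (q @ [OldE f])) @ BB S (map proj q)"
    by (rule carryB_path) (use s symmetric_path_is_path[OF assms] in simp)
  hence q: "BB S' q = BB S (map proj q)"
    using e s by simp
  let ?p = "if gsrc S (proj (hd s)) = gtgt S v then [v] else []"
  have p: "BB S ?p = []" by (simp add: gB_v)
  show ?thesis
  proof (cases "gtgt S f = gsrc S v")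
    case True
    hence "gB S f = gbw S f" using v_src by (simp add: gB_def)
    moreover have "unfold s = (?p @ map proj q @ [f]) @ [v]" using True by (simp add: unfold_def s)
    ultimately have "Bw S (unfold s) = BB S ?p @ BB S (map proj q) @ gbw S f @ gbw S v"
      by (simp only: Bw_snoc) simp
    thus ?thesis using True p v_word(4) q by (simp add: s Bw_snoc)
  next
    case False
    hence "unfold s = (?p @ map proj q) @ [f]" by (simp add: unfold_def s)
    hence "Bw S (unfold s) = BB S ?p @ BB S (map proj q) @ gbw S f"
      by (simp only: Bw_snoc) simp
    thus ?thesis using False p q by (simp add: s Bw_snoc)
  qed
qed

lemma S1_Fw_eq_Bw: "symmetric_path S' s \<Longrightarrow> Fw S' s = Bw S' s"
  using unfold_Fw unfold_Bw unfold_path Fw_eq_Bw by metis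

section \<open>Condition (4) for S'\<close>

lemma proj_eq_Old: "\<epsilon> \<in> gedges S' \<Longrightarrow> proj \<epsilon> \<noteq> v \<Longrightarrow> \<epsilon> = OldE (proj \<epsilon>)"
  by (cases \<epsilon>) auto

lemma New_neighbours:
  assumes p: "is_path S' s" and i: "0 < i" "Suc i < length s" "s ! i = New x y"
  shows "s ! (i - 1) = OldE x \<and> s ! Suc i = OldE y"
proof -
  have "gtgt S' (s ! (i - 1)) = gsrc S' (s ! i)" "gtgt S' (s ! i) = gsrc S' (s ! Suc i)"
    using p i unfolding is_path_def by (metis Suc_diff_1 Suc_lessD)+
  thus ?thesis using i(3) by (cases "s ! (i - 1)"; cases "s ! Suc i") (auto split: if_splits)
qed

text \<open>Only the indices of the \<open>v_ij\<close> are lost, and they can be read off from the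
  neighbouring edges \<open>x_i\<close> and \<open>y_j\<close>. The end conditions guarantee that
  every \<open>v\<close> has both neighbours.\<close>

lemma proj_inj:
  assumes "is_path S' s" "is_path S' t" "map proj s = map proj t"
    "proj (hd s) \<noteq> v" "proj (last s) \<noteq> v"
  shows "s = t"
proof (rule nth_equalityI)
  show len: "length s = length t" using assms(3) by (metis length_map)
  fix i assume i: "i < length s"
  have ne: "s \<noteq> []" "t \<noteq> []" using assms(1,2) by (auto simp: is_path_def)
  have E: "s ! j \<in> gedges S'" "t ! j \<in> gedges S'" if "j < length s" for j
    using assms(1,2) that len by (auto simp: is_path_def)
  have P: "proj (s ! j) = proj (t ! j)" if "j < length s" for j
    using assms(3) that len by (metis nth_map)
  show "s ! i = t ! i"
  proof (cases "proj (s ! i) = v")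
    case False
    thus ?thesis using proj_eq_Old E P i by metis
  next
    case True
    hence pos: "0 < i" "Suc i < length s"
      using assms(4,5) i ne(1) by (metis gr0I hd_conv_nth, metis Suc_lessI diff_Suc_1 last_conv_nth)
    obtain x y where xy: "s ! i = New x y" using True E(1)[OF i] by (cases "s ! i") auto
    obtain x' y' where xy': "t ! i = New x' y'" using True P[OF i] E(2)[OF i] by (cases "t ! i") auto
    have "s ! (i - 1) = OldE x \<and> s ! Suc i = OldE y" "t ! (i - 1) = OldE x' \<and> t ! Suc i = OldE y'"
      using New_neighbours assms(1,2) pos xy xy' len by metis+
    thus ?thesis using P[of "i - 1"] P[of "Suc i"] pos xy xy' by simp
  qed
qed

lemma infix_strip_left:
  assumes "p @ z = a @ y @ b" "y \<noteq> []" "hd y \<noteq> v" "p = [] \<or> p = [v]"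
  obtains a' where "z = a' @ y @ b" "a = p @ a'"
  using assms by (cases a) (auto simp: Cons_eq_append_conv)

lemma infix_strip_right:
  assumes "z @ q = y @ b" "y \<noteq> []" "last y \<noteq> v" "q = [] \<or> q = [v]"
  obtains b' where "z = y @ b'"
  using assms by (cases b rule: rev_cases) (auto simp: append_eq_append_conv2 Cons_eq_append_conv)

lemma S1_occ_Fw_le:
  assumes sym: "symmetric_path S' s1" "symmetric_path S' s2"
  shows "occ (Fw S' s1) (Fw S' s2) \<le> occ s1 s2"
proof -
  have "occ (Fw S' s1) (Fw S' s2) \<le> occ (unfold s1) (unfold s2)"
    unfolding unfold_Fw[OF sym(1)] unfold_Fw[OF sym(2)] by (intro occ_Fw_le unfold_path sym)
  also have "\<dots> \<le> occ s1 s2"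
  proof (rule occ_le)
    define pre where "pre s = (if gsrc S (proj (hd s)) = gtgt S v then [v] else [])" for s
    define post where "post s = (if gtgt S (proj (last s)) = gsrc S v then [v] else [])" for s
    have u: "unfold s = pre s @ map proj s @ post s" for s
      by (simp add: unfold_def pre_def post_def)
    fix a b assume eq: "unfold s2 = a @ unfold s1 @ b"
    obtain e f where ef: "e \<noteq> v" "hd s1 = OldE e" "f \<noteq> v" "last s1 = OldE f"
      using symmetric_S1_ends[OF sym(1)] by metis
    have p1: "is_path S' s1" and p2: "is_path S' s2" using sym by (auto simp: symmetric_path_def)
    have ne: "s1 \<noteq> []" using p1 by (simp add: is_path_def)
    have "pre s2 @ map proj s2 @ post s2 = (a @ pre s1) @ map proj s1 @ (post s1 @ b)"
      using eq by (simp add: u)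
    \<comment> \<open>The projected core neither begins nor ends with \<open>v\<close>, so stripping
      a \<open>v\<close> added at either end of \<open>unfold s2\<close> cannot cut into it.\<close>
    moreover have c: "map proj s1 \<noteq> []" "hd (map proj s1) \<noteq> v" "last (map proj s1) \<noteq> v"
      using ef ne by (simp_all add: hd_map last_map)
    moreover have "pre s2 = [] \<or> pre s2 = [v]" "post s2 = [] \<or> post s2 = [v]" by (simp_all add: pre_def post_def)
    ultimately obtain a' where a': "map proj s2 @ post s2 = a' @ map proj s1 @ (post s1 @ b)" "a @ pre s1 = pre s2 @ a'"
      using infix_strip_left by metis
    from a'(1) have eq2: "map proj s2 @ post s2 = (a' @ map proj s1) @ (post s1 @ b)" by simp
    obtain b' where "map proj s2 = (a' @ map proj s1) @ b'"
      by (rule infix_strip_right[OF eq2]) (use c in \<open>simp_all add: post_def\<close>)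
    hence "map proj s2 = a' @ (map proj s1 @ b')" by simp
    then obtain A C where C: "s2 = A @ C" "a' = map proj A" "map proj s1 @ b' = map proj C"
      unfolding map_eq_append_conv by (elim exE conjE)
    from C(3)[symmetric] obtain t B where "C = t @ B" "map proj s1 = map proj t"
      unfolding map_eq_append_conv by (elim exE conjE)
    hence s2: "s2 = A @ t @ B" "map proj A = a'" "map proj t = map proj s1" using C by simp_all
    have "t \<noteq> []" using s2(3) ne by auto
    hence "is_path S' t" using p2 s2(1) is_path_infix[of S' A t B] by simp
    hence "t = s1" using proj_inj[of s1 t] p1 s2(3) ef ne by simp
    \<comment> \<open>The two offsets differ by the \<open>v\<close> possibly added in front of
      \<open>s2\<close>, less the one possibly added in front of \<open>s1\<close>.\<close>
    moreover have "length A + length (pre s2) - length (pre s1) = length a"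
      using arg_cong[OF a'(2), of length] s2(2) by auto
    ultimately show "\<exists>a' b'. s2 = a' @ s1 @ b' \<and> length a' + length (pre s2) - length (pre s1) = length a"
      using s2(1) by blast
  qed
  finally show ?thesis .
qed

section \<open>Good edges and their marker words\<close>

definition good_edges :: "'e ex set" where
  "good_edges = {\<epsilon> \<in> gedges S'. good S W v \<epsilon>}"

lemma good_edge: "\<epsilon> \<in> good_edges \<Longrightarrow> \<epsilon> \<in> gedges S'"
  by (simp add: good_edges_def)

lemma finite_good_edges: "finite good_edges"
  using finite_S1_edges by (simp add: good_edges_def)

lemma good_edges_iff:
  "OldE e \<in> good_edges \<longleftrightarrow> e \<in> gedges S \<and> e \<noteq> v"
  "New x y \<in> good_edges \<longleftrightarrow> x \<in> xs_in S v \<and> y \<in> ys_out S v \<and> factor (gbw S x @ gfw S v @ gfw S y) W"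
  by (auto simp: good_edges_def good_def)

text \<open>Since \<open>[v]\<close> is symmetric, its word can be split off inside the path,
  preceded by the back word of \<open>x\<close> and followed by the front word of \<open>y\<close>.
  A symmetric path whose word is a factor of \<open>W\<close> therefore uses good pairs
  only.\<close>

lemma v_between:
  assumes "symmetric_path S (l @ [x, v, y] @ r)"
  shows "sublist (gbw S x @ gfw S v @ gfw S y) (Fw S (l @ [x, v, y] @ r))"
proof -
  have eq: "l @ [x, v, y] @ r = (l @ [x]) @ [v] @ (y # r)" by simp
  have p: "is_path S (l @ [x, v, y] @ r)" using assms by (rule symmetric_path_is_path)
  have "is_path S [x, v, y]" by (rule is_path_infix[OF p]) simp
  hence "gB S x = gbw S x" "gF S y = gfw S y" using v_src v_tgt
    by (auto simp: is_path_Cons gB_def gF_def)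
  hence "Fw S (l @ [x, v, y] @ r) = BB S l @ (gbw S x @ gfw S v @ gfw S y) @ FF S r"
    unfolding eq using symmetric_infix[of "l @ [x]" "[v]" "y # r"] assms v_word by simp
  thus ?thesis by (auto simp: sublist_def)
qed

text \<open>Traces an edge of S' at a position of a path in S, so that markers can be found before
  any lifting: \<open>v_ij\<close> is present only where \<open>v\<close> has both its neighbours in
  the path.\<close>

definition passes :: "'e list \<Rightarrow> 'e ex \<Rightarrow> nat \<Rightarrow> bool" where
  "passes s \<epsilon> i \<longleftrightarrow> i < length s \<and> (case \<epsilon> of OldE e \<Rightarrow> s ! i = e
     | New x y \<Rightarrow> 0 < i \<and> Suc i < length s \<and> s ! (i - 1) = x \<and> s ! i = v \<and> s ! Suc i = y)"

lemma passes_append: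
  assumes "passes t \<epsilon> i" shows "passes (a @ t @ b) \<epsilon> (length a + i)"
proof (cases \<epsilon>)
  case (New x y)
  hence "0 < i" "Suc i < length t" using assms by (auto simp: passes_def)
  moreover have at: "(a @ t @ b) ! (length a + j) = t ! j" if "j < length t" for j
    using that by (simp add: nth_append)
  moreover have "length a + i - 1 = length a + (i - 1)" using \<open>0 < i\<close> by simp
  ultimately show ?thesis using assms New at[of "i - 1"] at[of i] at[of "Suc i"]
    by (simp add: passes_def)
qed (use assms in \<open>auto simp: passes_def nth_append\<close>)

text \<open>For \<open>v_ij\<close> the middle \<open>V\<close> of \<open>X_i V Y_j\<close> is the
  word of the symmetric path \<open>[v]\<close>, so \<open>occurrence_synchronized\<close> locates
  an actual \<open>v\<close>; condition (2) then identifies its neighbours by the last letter of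
  \<open>X_i\<close> and the first letter of \<open>Y_j\<close>. Copied edges inherit their marker
  from (7) for S.\<close>

lemma good_edge_marker:
  assumes "\<epsilon> \<in> good_edges"
  shows "\<exists>u. factor u W \<and> (\<forall>s. symmetric_path S s \<and> sublist u (Fw S s) \<longrightarrow> (\<exists>i. passes s \<epsilon> i))"
proof (cases \<epsilon>)
  case (OldE e)
  thus ?thesis using edge_marker[of e] assms by (fastforce simp: good_edges_iff passes_def in_set_conv_nth)
next
  case (New x y)
  let ?u = "gbw S x @ gfw S v @ gfw S y"
  have xy: "x \<in> xs_in S v" "y \<in> ys_out S v" "factor ?u W" using assms New by (auto simp: good_edges_iff)
  have X: "gbw S x \<noteq> []" using gbw_nonempty xy(1) v_src by (simp add: xs_iff)
  have Y: "gfw S y \<noteq> []" using gfw_nonempty xy(2) v_tgt by (simp add: ys_iff)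
  have "\<exists>i. passes s \<epsilon> i" if s: "symmetric_path S s" "sublist ?u (Fw S s)" for s
  proof -
    obtain a b where ab: "Fw S s = a @ ?u @ b" using s(2) by (auto simp: sublist_def)
    hence "Fw S s = (a @ gbw S x) @ Fw S [v] @ (gfw S y @ b)" by (simp add: v_word)
    then obtain l r where lr: "s = l @ [v] @ r" "a @ gbw S x = BB S l" "gfw S y @ b = FF S r"
      using occurrence_synchronized[OF v_word(1) s(1)] by metis
    \<comment> \<open>Nonempty \<open>X_i\<close> and \<open>Y_j\<close> leave letters to be read
      before and after this \<open>v\<close>, so it is not at an end of the path.\<close>
    have "l \<noteq> []" "r \<noteq> []" using lr X Y by auto
    then obtain l' x' y' r' where l': "l = l' @ [x']" "r = y' # r'"
      by (metis neq_Nil_conv rev_exhaust)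
    have p: "is_path S (l' @ [x', v, y'] @ r')" using symmetric_path_is_path[OF s(1)] lr(1) l' by simp
    have "is_path S [x', v, y']" by (rule is_path_infix[OF p]) simp
    hence e: "x' \<in> gedges S" "gtgt S x' = gsrc S v" "y' \<in> gedges S" "gsrc S y' = gtgt S v"
      by (auto simp: is_path_Cons)
    have "a @ gbw S x = BB S l' @ gbw S x'" using lr(2) l' e v_src by (simp add: gB_def)
    hence "last (gbw S x) = last (gbw S x')" using X gbw_nonempty[of x'] e v_src by (metis last_appendR)
    moreover have "x \<in> gedges S" "gtgt S x = gsrc S v" using xy(1) xs_iff by blast+
    ultimately have "x' = x" using bw_distinct[of x x'] e v_src by metis
    have "gfw S y @ b = gfw S y' @ FF S r'" using lr(3) l' e v_tgt by (simp add: gF_def)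
    hence "hd (gfw S y) = hd (gfw S y')" using Y gfw_nonempty[of y'] e v_tgt by (metis hd_append2)
    moreover have "y \<in> gedges S" "gsrc S y = gtgt S v" using xy(2) ys_iff by blast+
    ultimately have "y' = y" using fw_distinct[of y y'] e v_tgt by metis
    show ?thesis using lr(1) l' New \<open>x' = x\<close> \<open>y' = y\<close>
      by (intro exI[of _ "Suc (length l')"]) (simp add: passes_def nth_append)
  qed
  thus ?thesis using xy(3) by blast
qed

text \<open>A marker for paths in S also serves S': an interior \<open>v\<close> of
  \<open>unfold s\<close> is not one of the copies added at the ends, and its neighbours fix the
  indices.\<close>

lemma S1_marker:
  assumes "\<epsilon> \<in> good_edges"
  shows "\<exists>u. factor u W \<and> (\<forall>s. symmetric_path S' s \<and> sublist u (Fw S' s) \<longrightarrow> \<epsilon> \<in> set s)"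
proof -
  have "\<epsilon> \<in> set s" if s: "symmetric_path S' s" "passes (unfold s) \<epsilon> i" for s i
  proof -
    have E: "set s \<subseteq> gedges S'" and p: "is_path S' s" and ne: "s \<noteq> []"
      using s(1) by (auto simp: symmetric_path_def is_path_def)
    define pre where "pre = (if gsrc S (proj (hd s)) = gtgt S v then [v] else [])"
    define post where "post = (if gtgt S (proj (last s)) = gsrc S v then [v] else [])"
    have u: "unfold s = pre @ map proj s @ post" "pre = [] \<or> pre = [v]" "post = [] \<or> post = [v]"
      by (simp_all add: unfold_def pre_def post_def)
    show ?thesis
    proof (cases \<epsilon>)
      case (OldE e)
      hence "e \<in> set (unfold s)" "e \<noteq> v" using s(2) assms by (auto simp: passes_def good_edges_iff)
      hence "e \<in> proj ` set s" using u by auto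
      thus ?thesis using proj_eq_Old E \<open>e \<noteq> v\<close> OldE by fastforce
    next
      case (New x y)
      note i = s(2)[unfolded passes_def New, simplified]
      \<comment> \<open>The position in \<open>s\<close> itself. As \<open>passes\<close> makes
        \<open>i\<close> positive and at most one \<open>v\<close> is added in front, the truncated
        subtraction is exact.\<close>
      define j where "j = i - length pre"
      have ij: "i = length pre + j" "j < length s" using i u by (auto simp: j_def)
      have at: "unfold s ! (length pre + k) = proj (s ! k)" if "k < length s" for k
        using that by (simp add: u(1) nth_append)
      obtain e f where ef: "e \<noteq> v" "hd s = OldE e" "f \<noteq> v" "last s = OldE f"
        using symmetric_S1_ends[OF s(1)] by metis
      have vj: "proj (s ! j) = v" using at[of j] ij i by simp
      have "j \<noteq> 0" using vj ef(1,2) ne by (metis hd_conv_nth proj.simps(1))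
      moreover have "j \<noteq> length s - 1" using vj ef(3,4) ne by (metis last_conv_nth proj.simps(1))
      ultimately have pos: "0 < j" "Suc j < length s" using ij by auto
      have "s ! j \<in> gedges S'" using E ij(2) by auto
      then obtain x' y' where xy: "s ! j = New x' y'" using vj by (cases "s ! j") auto
      have "s ! (j - 1) = OldE x' \<and> s ! Suc j = OldE y'" using New_neighbours[OF p pos xy] .
      hence "x' = x" "y' = y" using at[of "j - 1"] at[of "Suc j"] pos ij i by auto
      thus ?thesis using xy New ij(2) nth_mem[of j s] by simp
    qed
  qed
  thus ?thesis using good_edge_marker[OF assms] unfold_Fw unfold_path by metis
qed

text \<open>Meaningless if \<open>s ! i = v\<close> at either end of \<open>s\<close>, where \<open>v\<close> has no neighbour.\<close>

definition lift_at :: "'e list \<Rightarrow> nat \<Rightarrow> 'e ex" where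
  "lift_at s i = (if s ! i = v then New (s ! (i - 1)) (s ! Suc i) else OldE (s ! i))"

section \<open>Lifting paths of S with words in \<open>W\<close> to good paths of S'\<close>

lemma lift_at_passes: "passes s \<epsilon> i \<Longrightarrow> \<epsilon> \<in> good_edges \<Longrightarrow> lift_at s i = \<epsilon> \<and> (s ! i = v \<longrightarrow> 0 < i \<and> Suc i < length s)"
  by (cases \<epsilon>) (auto simp: passes_def lift_at_def good_edges_iff)

lemma lift_at_good:
  assumes s: "symmetric_path S s" "factor (Fw S s) W"
    and i: "i < length s" "s ! i = v \<Longrightarrow> 0 < i \<and> Suc i < length s"
  shows "lift_at s i \<in> good_edges"
proof (cases "s ! i = v")
  case True
  hence pos: "0 < i" "Suc i < length s" using i(2) by auto
  have p: "is_path S s" using s(1) by (rule symmetric_path_is_path)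
  have st: "gtgt S (s ! (i - 1)) = gsrc S v" "gsrc S (s ! Suc i) = gtgt S v"
    using p pos True unfolding is_path_def by (metis Suc_diff_1 Suc_lessD)+
  have E: "s ! (i - 1) \<in> gedges S" "s ! Suc i \<in> gedges S" using p pos by (auto simp: is_path_def)
  have "s = take (i - 1) s @ [s ! (i - 1), s ! i, s ! Suc i] @ drop (Suc (Suc i)) s"
    using pos by (metis Cons_nth_drop_Suc Suc_diff_1 Suc_lessD append_Cons append_Nil append_take_drop_id)
  hence "sublist (gbw S (s ! (i - 1)) @ gfw S v @ gfw S (s ! Suc i)) (Fw S s)"
    using v_between[of "take (i - 1) s" "s ! (i - 1)" "s ! Suc i" "drop (Suc (Suc i)) s"] s(1) True by metis
  thus ?thesis using factor_mono[OF s(2)] True st E by (simp add: lift_at_def good_edges_iff xs_in_def ys_out_def)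
next
  case False
  thus ?thesis using s(1) i(1) by (auto simp: lift_at_def good_edges_iff symmetric_path_def is_path_def)
qed

lemma lift_path:
  assumes s: "symmetric_path S s" "factor (Fw S s) W"
    and lh: "lo < hi" "hi \<le> length s"
    and inner: "\<And>i. lo \<le> i \<Longrightarrow> i < hi \<Longrightarrow> s ! i = v \<Longrightarrow> 0 < i \<and> Suc i < length s"
  shows "is_path S' (map (lift_at s) [lo..<hi])" "set (map (lift_at s) [lo..<hi]) \<subseteq> good_edges"
proof -
  show sub: "set (map (lift_at s) [lo..<hi]) \<subseteq> good_edges"
    using lift_at_good[OF s] lh inner by auto
  have "gtgt S' (lift_at s i) = gsrc S' (lift_at s (Suc i))" if i: "lo \<le> i" "Suc i < hi" for i
  proof -
    have E: "s ! i \<in> gedges S" "s ! Suc i \<in> gedges S" and st: "gtgt S (s ! i) = gsrc S (s ! Suc i)"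
      using s(1) i lh by (auto simp: symmetric_path_def is_path_def)
    show ?thesis using st v_src_ne_tgt E src_eq_v[of "s ! Suc i"] tgt_eq_v[of "s ! i"]
      by (auto simp: lift_at_def)
  qed
  thus "is_path S' (map (lift_at s) [lo..<hi])"
    using sub lh good_edge unfolding is_path_def by auto
qed

text \<open>Inverse of \<open>unfold\<close>: a \<open>v\<close> at either end is dropped, and its
  word survives in the front word \<open>V Y_j\<close> or the back word \<open>X_i V\<close> of the
  edge next to it. For \<open>[v]\<close> nothing would remain. The last clause says that no
  position with a meaningful lift is lost.\<close>

lemma symmetric_lift:
  assumes s: "symmetric_path S s" "factor (Fw S s) W" "s \<noteq> [v]"
  obtains lo hi where "symmetric_path S' (map (lift_at s) [lo..<hi])" "set (map (lift_at s) [lo..<hi]) \<subseteq> good_edges"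
    "Fw S' (map (lift_at s) [lo..<hi]) = Fw S s" "hi \<le> length s"
    "\<And>i. i < length s \<Longrightarrow> (s ! i = v \<longrightarrow> 0 < i \<and> Suc i < length s) \<Longrightarrow> lo \<le> i \<and> i < hi"
proof -
  define lo where "lo = (if hd s = v then 1 else 0 :: nat)"
  define hi where "hi = (if last s = v then length s - 1 else length s)"
  have p: "is_path S s" and ne: "s \<noteq> []" using s(1) by (auto simp: symmetric_path_def is_path_def)
  have E: "s ! i \<in> gedges S" if "i < length s" for i using p that by (auto simp: is_path_def)
  have st: "gtgt S (s ! i) = gsrc S (s ! Suc i)" if "Suc i < length s" for i using p that by (auto simp: is_path_def)
  have h: "hd s = s ! 0" "last s = s ! (length s - 1)" using ne by (simp_all add: hd_conv_nth last_conv_nth)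
  have lohi: "lo < hi"
  proof (cases "length s = 1")
    case True
    thus ?thesis using s(3) h by (cases s) (auto simp: lo_def hi_def)
  next
    case len: False
    hence len: "2 \<le> length s" using ne by (cases s) (auto simp: Suc_le_eq)
    show ?thesis
    proof (cases "length s = 2")
      case True
      \<comment> \<open>The path \<open>[v, v]\<close>, which would be stripped to nothing, is
        impossible because \<open>v\<close> is not a loop.\<close>
      hence "\<not> (hd s = v \<and> last s = v)" using h st[of 0] v_src_ne_tgt by auto
      thus ?thesis using True by (auto simp: lo_def hi_def)
    qed (use len in \<open>auto simp: lo_def hi_def\<close>)
  qed
  have hilen: "hi \<le> length s" by (simp add: hi_def)
  have inner: "0 < i \<and> Suc i < length s" if "lo \<le> i" "i < hi" "s ! i = v" for i
    using that h ne by (cases "i = 0"; cases "i = length s - 1") (auto simp: lo_def hi_def split: if_splits)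
  let ?m = "map (lift_at s) [lo..<hi]"
  note path = lift_path[OF s(1,2) lohi hilen inner]
  have hdm: "hd ?m = lift_at s lo" using lohi by (simp add: hd_map)
  have lastm: "last ?m = lift_at s (hi - 1)" using lohi by (simp add: last_map)
  have lo: "s ! lo \<noteq> v \<and> (coll S (gsrc S (s ! lo)) \<and> hd s \<noteq> v \<or> gsrc S (s ! lo) = gtgt S v \<and> hd s = v)"
  proof (cases "hd s = v")
    case True
    hence "lo = 1" "1 < length s" using lohi hilen by (auto simp: lo_def)
    thus ?thesis using True h st[of 0] v_src_ne_tgt by (auto simp: lo_def)
  next
    case False
    thus ?thesis using h s(1) by (simp add: lo_def symmetric_path_def)
  qed
  have hi: "s ! (hi - 1) \<noteq> v \<and> (distr S (gtgt S (s ! (hi - 1))) \<and> last s \<noteq> v \<or> gtgt S (s ! (hi - 1)) = gsrc S v \<and> last s = v)"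
  proof (cases "last s = v")
    case True
    hence "hi = length s - 1" "1 < length s" using lohi hilen by (auto simp: hi_def)
    moreover from this have "Suc (hi - 1) = length s - 1" using lohi by simp
    ultimately have "gtgt S (s ! (hi - 1)) = gsrc S v" using True h st[of "hi - 1"] by simp
    thus ?thesis using True v_src_ne_tgt by auto
  next
    case False
    thus ?thesis using h s(1) by (simp add: hi_def symmetric_path_def)
  qed
  have ends: "lift_at s lo = OldE (s ! lo)" "lift_at s (hi - 1) = OldE (s ! (hi - 1))"
    using lo hi by (simp_all add: lift_at_def)
  have "s ! lo \<in> gedges S" "s ! (hi - 1) \<in> gedges S" using E lohi hilen by simp_all
  hence K: "coll S' (gsrc S' (OldE (s ! lo))) \<longleftrightarrow> coll S (gsrc S (s ! lo)) \<or> gsrc S (s ! lo) = gtgt S v"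
    "distr S' (gtgt S' (OldE (s ! (hi - 1)))) \<longleftrightarrow> distr S (gtgt S (s ! (hi - 1))) \<or> gtgt S (s ! (hi - 1)) = gsrc S v"
    using lo hi by (intro S1_endpoint_kinds; blast)+
  have kinds: "coll S' (gsrc S' (hd ?m))" "distr S' (gtgt S' (last ?m))"
    unfolding hdm lastm ends K using lo hi by blast+
  have sym: "symmetric_path S' ?m" unfolding symmetric_path_def by (intro conjI path(1) kinds)
  have pl: "proj (lift_at s i) = s ! i" for i by (simp add: lift_at_def)
  have "unfold ?m = (if hd s = v then [v] else []) @ map ((!) s) [lo..<hi] @ (if last s = v then [v] else [])"
  proof -
    have "gsrc S (s ! lo) = gtgt S v \<longleftrightarrow> hd s = v" "gtgt S (s ! (hi - 1)) = gsrc S v \<longleftrightarrow> last s = v"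
      using lo hi not_distr_coll v_src v_tgt by metis+
    thus ?thesis unfolding unfold_def hdm lastm pl by (simp add: pl)
  qed
  also have "\<dots> = map ((!) s) ([0..<lo] @ [lo..<hi] @ [hi..<length s])"
  proof -
    have "map ((!) s) [0..<lo] = (if hd s = v then [v] else [])" using h by (simp add: lo_def)
    moreover have "map ((!) s) [hi..<length s] = (if last s = v then [v] else [])"
      using ne by (cases s rule: rev_cases) (simp_all add: hi_def)
    ultimately show ?thesis by simp
  qed
  also have "\<dots> = s" using lohi hilen by (simp add: upt_append map_nth)
  finally have "Fw S' ?m = Fw S s" using unfold_Fw[OF sym] by simp
  moreover have "lo \<le> i \<and> i < hi" if "i < length s" "s ! i = v \<longrightarrow> 0 < i \<and> Suc i < length s" for i
    using that h ne by (cases "i = 0"; cases "i = length s - 1") (auto simp: lo_def hi_def)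
  ultimately show ?thesis using that[of lo hi] sym path(2) hilen by blast
qed

text \<open>With \<open>w = []\<close> this connects two good edges; with arbitrary \<open>w\<close>
  it also yields covering paths made of good edges. That the whole word is a factor of
  \<open>W\<close> serves condition (5) of S''.\<close>

lemma good_path_through:
  assumes \<epsilon>: "\<epsilon> \<in> good_edges" and \<delta>: "\<delta> \<in> good_edges" and w: "factor w W"
  obtains l p r where "symmetric_path S' (l @ (\<epsilon> # p @ [\<delta>]) @ r)" "set (l @ (\<epsilon> # p @ [\<delta>]) @ r) \<subseteq> good_edges"
    "factor (Fw S' (l @ (\<epsilon> # p @ [\<delta>]) @ r)) W" "sublist w (Fw S' (l @ (\<epsilon> # p @ [\<delta>]) @ r))"
proof -
  obtain u x where u: "factor u W" "\<And>s. symmetric_path S s \<Longrightarrow> sublist u (Fw S s) \<Longrightarrow> \<exists>i. passes s \<epsilon> i"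
    and x: "factor x W" "\<And>s. symmetric_path S s \<Longrightarrow> sublist x (Fw S s) \<Longrightarrow> \<exists>i. passes s \<delta> i"
    using good_edge_marker[OF \<epsilon>] good_edge_marker[OF \<delta>] by metis
  obtain t1 q t2 where t: "symmetric_path S (t1 @ q @ t2)" "symmetric_path S t1" "symmetric_path S t2"
    "sublist u (Fw S t1)" "sublist x (Fw S t2)" "sublist w (Fw S (t1 @ q @ t2))"
    "factor (Fw S (t1 @ q @ t2)) W"
    using symmetric_path_through[OF u(1) w x(1)] by metis
  define s where "s = t1 @ q @ t2"
  obtain i where i: "passes t1 \<epsilon> i" using u(2) t by metis
  obtain j where j: "passes t2 \<delta> j" using x(2) t by metis
  define k where "k = length (t1 @ q) + j"
  have pi: "passes s \<epsilon> i" using passes_append[OF i, of "[]" "q @ t2"] by (simp add: s_def)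
  have pk: "passes s \<delta> k" using passes_append[OF j, of "t1 @ q" "[]"] by (simp add: s_def k_def)
  have ik: "i < k" "k < length s" using i j by (auto simp: passes_def k_def s_def)
  have "s \<noteq> [v]" using ik by auto
  then obtain lo hi where m: "symmetric_path S' (map (lift_at s) [lo..<hi])" "set (map (lift_at s) [lo..<hi]) \<subseteq> good_edges"
    "Fw S' (map (lift_at s) [lo..<hi]) = Fw S s"
    "\<And>i. i < length s \<Longrightarrow> (s ! i = v \<longrightarrow> 0 < i \<and> Suc i < length s) \<Longrightarrow> lo \<le> i \<and> i < hi"
    using symmetric_lift[of s] t s_def by metis
  have "lo \<le> i" "k < hi" using m(4)[of i] m(4)[of k] lift_at_passes pi pk \<epsilon> \<delta> ik by auto
  hence "[lo..<hi] = [lo..<i] @ (i # [Suc i..<k] @ [k]) @ [Suc k..<hi]"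
    using ik by (metis append_Cons append_Nil append_assoc less_imp_le_nat order_le_less_trans upt_append upt_conv_Cons Suc_leI order_le_less)
  hence "map (lift_at s) [lo..<hi] = map (lift_at s) [lo..<i] @ (\<epsilon> # map (lift_at s) [Suc i..<k] @ [\<delta>]) @ map (lift_at s) [Suc k..<hi]"
    using lift_at_passes pi pk \<epsilon> \<delta> by simp
  thus ?thesis using that m(1-3) t(6,7) s_def by metis
qed

end

section \<open>Forced continuations\<close>

text \<open>Unique continuation is required only at the interior vertices of \<open>p\<close>,
  whereas \<open>q\<close> may meet choices once it has left \<open>p\<close> behind. As long as
  both last, the two paths are forced to agree.\<close>

lemma path_determined:
  assumes "is_path G p" "is_path G q" "set p \<subseteq> A" "set q \<subseteq> A" "hd p = hd q"
    "\<And>a e f. a \<in> set (butlast p) \<Longrightarrow> e \<in> A \<Longrightarrow> f \<in> A \<Longrightarrow> gsrc G e = gtgt G a \<Longrightarrow> gsrc G f = gtgt G a \<Longrightarrow> e = f"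
  shows "prefix p q \<or> prefix q p"
  using assms
proof (induction p arbitrary: q)
  case (Cons a p)
  obtain q' where q: "q = a # q'" using Cons.prems(2,5) by (cases q) (auto simp: is_path_def)
  show ?case
  proof (cases "p = [] \<or> q' = []")
    case False
    hence "gsrc G (hd p) = gtgt G a" "gsrc G (hd q') = gtgt G a" "is_path G p" "is_path G q'"
      using Cons.prems(1,2) q by (auto simp: is_path_Cons)
    moreover have "hd p \<in> A" "hd q' \<in> A" using False Cons.prems(3,4) q by auto
    moreover have "a \<in> set (butlast (a # p))" using False by simp
    ultimately have "hd p = hd q'" using Cons.prems(6) by blast
    hence "prefix p q' \<or> prefix q' p"
      using Cons.prems q False \<open>is_path G p\<close> \<open>is_path G q'\<close> by (intro Cons.IH) auto
    thus ?thesis by (simp add: q)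
  qed (auto simp: q)
qed (simp add: is_path_def)

lemma path_determined_backward:
  assumes "is_path G p" "is_path G q" "set p \<subseteq> A" "set q \<subseteq> A" "last p = last q"
    "\<And>a e f. a \<in> set (tl p) \<Longrightarrow> e \<in> A \<Longrightarrow> f \<in> A \<Longrightarrow> gtgt G e = gsrc G a \<Longrightarrow> gtgt G f = gsrc G a \<Longrightarrow> e = f"
  shows "suffix p q \<or> suffix q p"
  using assms
proof (induction p arbitrary: q rule: rev_induct)
  case (snoc a p)
  obtain q' where q: "q = q' @ [a]" using snoc.prems(2,5) by (cases q rule: rev_cases) (auto simp: is_path_def)
  show ?case
  proof (cases "p = [] \<or> q' = []")
    case False
    hence "gtgt G (last p) = gsrc G a" "gtgt G (last q') = gsrc G a" "is_path G p" "is_path G q'"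
      using snoc.prems(1,2) q by (auto simp: is_path_append)
    moreover have "last p \<in> A" "last q' \<in> A" using False snoc.prems(3,4) q by auto
    moreover have "a \<in> set (tl (p @ [a]))" using False by simp
    ultimately have "last p = last q'" using snoc.prems(6) by blast
    moreover have "set (tl p) \<subseteq> set (tl (p @ [a]))" using False by auto
    hence "e = f" if "b \<in> set (tl p)" "e \<in> A" "f \<in> A" "gtgt G e = gsrc G b" "gtgt G f = gsrc G b" for b e f
      using snoc.prems(6)[of b e f] that by blast
    ultimately have "suffix p q' \<or> suffix q' p"
      using snoc.prems(3,4) q \<open>is_path G p\<close> \<open>is_path G q'\<close> by (intro snoc.IH) simp_all
    thus ?thesis by (auto simp: q suffix_def)
  qed (auto simp: q suffix_def)
qed (simp add: is_path_def)

lemma prefix_last_in_butlast: "prefix q p \<Longrightarrow> q \<noteq> p \<Longrightarrow> q \<noteq> [] \<Longrightarrow> last q \<in> set (butlast p)"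
proof -
  assume "prefix q p" "q \<noteq> p" "q \<noteq> []"
  then obtain z where "p = q @ z" "z \<noteq> []" by (auto simp: prefix_def)
  thus ?thesis using \<open>q \<noteq> []\<close> by (simp add: butlast_append)
qed

lemma suffix_hd_in_tl: "suffix q p \<Longrightarrow> q \<noteq> p \<Longrightarrow> q \<noteq> [] \<Longrightarrow> hd q \<in> set (tl p)"
proof -
  assume "suffix q p" "q \<noteq> p" "q \<noteq> []"
  then obtain z where "p = z @ q" "z \<noteq> []" by (auto simp: suffix_def)
  thus ?thesis using \<open>q \<noteq> []\<close> by simp
qed

lemma path_inner_vertices: "is_path G p \<Longrightarrow> gtgt G ` set (butlast p) = gsrc G ` set (tl p)"
proof (induction p)
  case (Cons a p)
  show ?case
  proof (cases p)
    case (Cons b q)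
    thus ?thesis using Cons.IH Cons.prems by (simp add: is_path_Cons)
  qed simp
qed (simp add: is_path_def)

lemma is_path_join:
  "is_path G (x @ [a]) \<Longrightarrow> is_path G (a # y) \<Longrightarrow> is_path G (x @ a # y)"
  by (cases "x = []"; cases "y = []") (auto simp: is_path_append)

lemma path_adj_rtrancl: "is_path G p \<Longrightarrow> (gsrc G (hd p), gtgt G (last p)) \<in> (adj G)\<^sup>*"
proof (induction p)
  case (Cons a p)
  have a: "(gsrc G a, gtgt G a) \<in> adj G" using Cons.prems by (auto simp: is_path_Cons adj_def)
  show ?case
  proof (cases "p = []")
    case True
    thus ?thesis using a by auto
  next
    case False
    thus ?thesis using a Cons by (auto simp: is_path_Cons intro: converse_rtrancl_into_rtrancl)
  qed
qed (simp add: is_path_def)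

lemma in_butlast_concat:
  "[] \<notin> set ps \<Longrightarrow> a \<in> set (butlast (concat ps)) \<Longrightarrow>
    (\<exists>p\<in>set ps. a \<in> set (butlast p)) \<or> (\<exists>p\<in>set (butlast ps). a = last p)"
proof (induction ps)
  case (Cons p ps)
  show ?case
  proof (cases "ps = []")
    case False
    hence "concat ps \<noteq> []" using Cons.prems(1) by (cases ps) auto
    hence "a \<in> set p \<or> a \<in> set (butlast (concat ps))"
      using Cons.prems(2) butlast_append[of p "concat ps"] by (auto simp del: concat_eq_Nil_conv)
    moreover have "a \<in> set (butlast p) \<or> a = last p" if "a \<in> set p"
      using that by (metis append_butlast_last_id empty_iff empty_set in_set_butlast_appendI rotate1.simps(2) set_ConsD set_rotate1 split_list)
    ultimately show ?thesis using Cons False by auto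
  qed (use Cons.prems in simp)
qed simp

lemma in_tl_concat:
  "[] \<notin> set ps \<Longrightarrow> a \<in> set (tl (concat ps)) \<Longrightarrow>
    (\<exists>p\<in>set ps. a \<in> set (tl p)) \<or> (\<exists>p\<in>set (tl ps). a = hd p)"
proof (cases ps)
  case (Cons p qs)
  assume ne: "[] \<notin> set ps" and "a \<in> set (tl (concat ps))"
  hence "a \<in> set (tl p) \<or> a \<in> set (concat qs)" using Cons by (cases p) auto
  moreover have "a \<in> set (tl q) \<or> a = hd q" if "a \<in> set q" for q
    using that by (cases q) auto
  ultimately show ?thesis using Cons by auto
qed simp

lemma hd_concat: "[] \<notin> set ps \<Longrightarrow> ps \<noteq> [] \<Longrightarrow> hd (concat ps) = hd (hd ps)"
  by (cases ps) auto

lemma last_concat: "[] \<notin> set ps \<Longrightarrow> ps \<noteq> [] \<Longrightarrow> last (concat ps) = last (last ps)"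
  by (cases ps rule: rev_cases) auto

lemma card_ge2_iff: "finite A \<Longrightarrow> 2 \<le> card A \<longleftrightarrow> (\<exists>a\<in>A. \<exists>b\<in>A. a \<noteq> b)"
  using card_le_Suc0_iff_eq[of A] by (auto simp: not_le[symmetric] Suc_le_eq numeral_2_eq_2)

context evolution
begin

section \<open>The graph $S''$\<close>

abbreviation T where "T \<equiv> S2_top S W v"
abbreviation S'' where "S'' \<equiv> S2 S W v"
abbreviation P where "P \<equiv> persistent S W v"
abbreviation Ed where "Ed \<equiv> S2_edges S W v"

section \<open>Good paths and persistent vertices\<close>

definition gpath :: "'e ex list \<Rightarrow> bool" where
  "gpath p \<longleftrightarrow> is_path S' p \<and> set p \<subseteq> good_edges"

lemma gpath_path: "gpath p \<Longrightarrow> is_path S' p" and gpath_good: "gpath p \<Longrightarrow> set p \<subseteq> good_edges"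
  and gpath_nonempty: "gpath p \<Longrightarrow> p \<noteq> []"
  by (auto simp: gpath_def is_path_def)

lemma gpath_append:
  "p \<noteq> [] \<Longrightarrow> q \<noteq> [] \<Longrightarrow> gpath (p @ q) \<longleftrightarrow> gpath p \<and> gpath q \<and> gtgt S' (last p) = gsrc S' (hd q)"
  by (auto simp: gpath_def is_path_append)

lemma gpath_between:
  assumes "\<epsilon> \<in> good_edges" "\<delta> \<in> good_edges"
  obtains p where "gpath (\<epsilon> # p @ [\<delta>])"
proof -
  have "factor [] W" by (simp add: factor_def)
  then obtain l p r where "symmetric_path S' (l @ (\<epsilon> # p @ [\<delta>]) @ r)" "set (l @ (\<epsilon> # p @ [\<delta>]) @ r) \<subseteq> good_edges"
    using good_path_through[OF assms] by metis
  hence "gpath (\<epsilon> # p @ [\<delta>])"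
    using is_path_infix[of S' l "\<epsilon> # p @ [\<delta>]" r] by (auto simp: gpath_def symmetric_path_def)
  thus ?thesis using that by blast
qed

lemma good_out_edge:
  assumes "\<epsilon> \<in> good_edges"
  obtains \<delta> where "\<delta> \<in> good_edges" "gsrc S' \<delta> = gtgt S' \<epsilon>"
proof -
  obtain p where p: "gpath (\<epsilon> # p @ [\<epsilon>])" using gpath_between[OF assms assms] .
  hence "gtgt S' \<epsilon> = gsrc S' (hd (p @ [\<epsilon>]))" "hd (p @ [\<epsilon>]) \<in> good_edges"
    by (simp add: gpath_def is_path_Cons, cases p) (use p in \<open>auto simp: gpath_def\<close>)
  thus ?thesis using that by metis
qed

lemma good_in_edge:
  assumes "\<epsilon> \<in> good_edges"
  obtains \<delta> where "\<delta> \<in> good_edges" "gtgt S' \<delta> = gsrc S' \<epsilon>"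
proof -
  obtain p where p: "gpath (\<epsilon> # p @ [\<epsilon>])" using gpath_between[OF assms assms] .
  have "gpath ((\<epsilon> # p) @ [\<epsilon>])" using p by simp
  hence "gtgt S' (last (\<epsilon> # p)) = gsrc S' \<epsilon>" "gpath (\<epsilon> # p)"
    by (simp_all only: gpath_append list.simps list.sel not_False_eq_True)
  moreover have "last (\<epsilon> # p) \<in> good_edges" using calculation(2) by (meson gpath_good last_in_set list.discI subsetD)
  ultimately show ?thesis using that by metis
qed

lemma persistent_iff:
  "P u \<longleftrightarrow> u \<in> gverts S' \<and>
    ((\<exists>\<epsilon>\<in>good_edges. \<exists>\<delta>\<in>good_edges. gsrc S' \<epsilon> = u \<and> gsrc S' \<delta> = u \<and> \<epsilon> \<noteq> \<delta>) \<or>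
     (\<exists>\<epsilon>\<in>good_edges. \<exists>\<delta>\<in>good_edges. gtgt S' \<epsilon> = u \<and> gtgt S' \<delta> = u \<and> \<epsilon> \<noteq> \<delta>))"
proof -
  have "2 \<le> card {\<epsilon> \<in> gedges S'. good S W v \<epsilon> \<and> f \<epsilon> = u} \<longleftrightarrow>
     (\<exists>\<epsilon>\<in>good_edges. \<exists>\<delta>\<in>good_edges. f \<epsilon> = u \<and> f \<delta> = u \<and> \<epsilon> \<noteq> \<delta>)" for f :: "'e ex \<Rightarrow> ('v, 'e) vx"
    using card_ge2_iff[of "{\<epsilon> \<in> gedges S'. good S W v \<epsilon> \<and> f \<epsilon> = u}"] finite_S1_edges
    by (auto simp: good_edges_def)
  thus ?thesis unfolding persistent_def by blast
qed

lemma persistent_vert: "P u \<Longrightarrow> u \<in> gverts S'"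
  by (simp add: persistent_def)

lemma nonpersistent_out_unique:
  "\<not> P u \<Longrightarrow> \<epsilon> \<in> good_edges \<Longrightarrow> \<delta> \<in> good_edges \<Longrightarrow> gsrc S' \<epsilon> = u \<Longrightarrow> gsrc S' \<delta> = u \<Longrightarrow> \<epsilon> = \<delta>"
  using persistent_iff S1_src_vert good_edge by metis

lemma nonpersistent_in_unique:
  "\<not> P u \<Longrightarrow> \<epsilon> \<in> good_edges \<Longrightarrow> \<delta> \<in> good_edges \<Longrightarrow> gtgt S' \<epsilon> = u \<Longrightarrow> gtgt S' \<delta> = u \<Longrightarrow> \<epsilon> = \<delta>"
  using persistent_iff S1_tgt_vert good_edge by metis

lemma persistent_out_edge:
  assumes "P u" obtains \<epsilon> where "\<epsilon> \<in> good_edges" "gsrc S' \<epsilon> = u"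
  using assms good_out_edge unfolding persistent_iff by metis

lemma persistent_in_edge:
  assumes "P u" obtains \<epsilon> where "\<epsilon> \<in> good_edges" "gtgt S' \<epsilon> = u"
  using assms good_in_edge unfolding persistent_iff by metis

text \<open>A distributing vertex of S' has a single incoming edge, so its persistence can only come
  from two good outgoing ones.\<close>

lemma persistent_distr_out:
  assumes "P u" "distr S' u"
  obtains \<epsilon> \<delta> where "\<epsilon> \<in> good_edges" "\<delta> \<in> good_edges" "gsrc S' \<epsilon> = u" "gsrc S' \<delta> = u" "\<epsilon> \<noteq> \<delta>"
  using assms distr_in_unique[OF assms(2)] good_edge unfolding persistent_iff by metis

lemma persistent_coll_in:
  assumes "P u" "coll S' u"
  obtains \<epsilon> \<delta> where "\<epsilon> \<in> good_edges" "\<delta> \<in> good_edges" "gtgt S' \<epsilon> = u" "gtgt S' \<delta> = u" "\<epsilon> \<noteq> \<delta>"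
  using assms coll_out_unique[OF assms(2)] good_edge unfolding persistent_iff by metis

lemma T_simps [simp]:
  "gverts T = {u. P u}" "gedges T = Ed" "gsrc T p = gsrc S' (hd p)" "gtgt T p = gtgt S' (last p)"
  "gverts S'' = {u. P u}" "gedges S'' = Ed" "gsrc S'' p = gsrc S' (hd p)" "gtgt S'' p = gtgt S' (last p)"
  "gfw S'' p = Fw S' (concat (nat_rext T [p]))" "gbw S'' p = Bw S' (concat (nat_lext T [p]))"
  by (simp_all add: S2_top_def S2_def)

lemma S2_T: "is_path S'' = is_path T" "distr S'' = distr T" "coll S'' = coll T" "adj S'' = adj T"
  "indeg S'' = indeg T" "outdeg S'' = outdeg T"
  by (auto simp: fun_eq_iff is_path_def distr_def coll_def indeg_def outdeg_def adj_def)

section \<open>Edges of S'' as blocks of good edges\<close>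

lemma Ed_iff: "p \<in> Ed \<longleftrightarrow> gpath p \<and> P (gsrc S' (hd p)) \<and> P (gtgt S' (last p)) \<and> (\<forall>a\<in>set (butlast p). \<not> P (gtgt S' a))"
proof -
  have "(\<forall>i. Suc i < length p \<longrightarrow> \<not> P (gtgt S' (p ! i))) \<longleftrightarrow> (\<forall>a\<in>set (butlast p). \<not> P (gtgt S' a))"
    by (simp add: all_set_conv_all_nth nth_butlast less_diff_conv)
  thus ?thesis unfolding S2_edges_def gpath_def good_edges_def is_path_def by blast
qed

lemma Ed_gpath: "p \<in> Ed \<Longrightarrow> gpath p" and Ed_nonempty: "p \<in> Ed \<Longrightarrow> p \<noteq> []" "ps \<subseteq> Ed \<Longrightarrow> [] \<notin> ps"
  and Ed_src: "p \<in> Ed \<Longrightarrow> P (gsrc S' (hd p))" and Ed_tgt: "p \<in> Ed \<Longrightarrow> P (gtgt S' (last p))"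
  by (auto simp: Ed_iff gpath_def is_path_def)

lemma Ed_inner_tgt: "p \<in> Ed \<Longrightarrow> a \<in> set (butlast p) \<Longrightarrow> \<not> P (gtgt S' a)"
  by (simp add: Ed_iff)

lemma Ed_inner_src: "p \<in> Ed \<Longrightarrow> a \<in> set (tl p) \<Longrightarrow> \<not> P (gsrc S' a)"
proof -
  assume p: "p \<in> Ed" "a \<in> set (tl p)"
  hence "gsrc S' a \<in> gtgt S' ` set (butlast p)"
    using path_inner_vertices[OF gpath_path[OF Ed_gpath[OF p(1)]]] by simp
  thus ?thesis using Ed_inner_tgt[OF p(1)] by auto
qed

text \<open>Nonpersistent vertices offer no choice, so one path is a prefix of the other; a proper
  prefix would end at an interior, hence nonpersistent, vertex of the longer one. Edges of S'' can
  thus be identified by their first edges in S', which also makes their number finite.\<close>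

lemma Ed_hd_inj:
  assumes "p \<in> Ed" "q \<in> Ed" "hd p = hd q" shows "p = q"
proof -
  have "prefix p q \<or> prefix q p"
    using assms Ed_gpath gpath_path gpath_good Ed_inner_tgt nonpersistent_out_unique
    by (intro path_determined[of S' p q good_edges]) metis+
  thus ?thesis
    using prefix_last_in_butlast Ed_inner_tgt Ed_tgt Ed_nonempty(1) assms by metis
qed

lemma Ed_last_inj:
  assumes "p \<in> Ed" "q \<in> Ed" "last p = last q" shows "p = q"
proof -
  have "suffix p q \<or> suffix q p"
    using assms Ed_gpath gpath_path gpath_good Ed_inner_src nonpersistent_in_unique
    by (intro path_determined_backward[of S' p q good_edges]) metis+
  thus ?thesis
    using suffix_hd_in_tl Ed_inner_src Ed_src Ed_nonempty(1) assms by metis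
qed

lemma finite_Ed: "finite Ed"
proof (rule inj_on_finite)
  show "inj_on hd Ed" using Ed_hd_inj by (auto intro: inj_onI)
  show "hd ` Ed \<subseteq> good_edges" using Ed_gpath by (fastforce simp: gpath_def is_path_def)
qed (rule finite_good_edges)

lemma gpath_split_first:
  assumes "gpath c" "P (gsrc S' (hd c))" "P (gtgt S' (last c))"
  obtains p c' where "c = p @ c'" "p \<in> Ed"
proof -
  have "\<exists>a\<in>set c. P (gtgt S' a)" using assms gpath_nonempty by (metis last_in_set)
  then obtain x a y where c: "c = x @ a # y" "P (gtgt S' a)" "\<forall>z\<in>set x. \<not> P (gtgt S' z)"
    using split_list_first_prop[of c "\<lambda>a. P (gtgt S' a)"] by blast
  have "gpath (x @ [a])" using assms(1) c(1) is_path_infix[of S' "[]" "x @ [a]" y] by (auto simp: gpath_def)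
  hence "x @ [a] \<in> Ed" using assms(2) c by (cases x) (auto simp: Ed_iff)
  thus ?thesis using that[of "x @ [a]" y] c(1) by simp
qed

lemma gpath_split_last:
  assumes "gpath c" "P (gsrc S' (hd c))" "P (gtgt S' (last c))"
  obtains p c' where "c = c' @ p" "p \<in> Ed"
proof -
  have "\<exists>a\<in>set c. P (gsrc S' a)" using assms gpath_nonempty by (metis hd_in_set)
  then obtain x a y where c: "c = x @ a # y" "P (gsrc S' a)" "\<forall>z\<in>set y. \<not> P (gsrc S' z)"
    using split_list_last_prop[of c "\<lambda>a. P (gsrc S' a)"] by blast
  have g: "gpath (a # y)" using assms(1) c(1) is_path_infix[of S' x "a # y" "[]"] by (auto simp: gpath_def)
  have "gtgt S' ` set (butlast (a # y)) = gsrc S' ` set y"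
    using path_inner_vertices[OF gpath_path[OF g]] by simp
  hence "\<forall>z\<in>set (butlast (a # y)). \<not> P (gtgt S' z)" using c(3) by (metis imageE imageI)
  hence "a # y \<in> Ed" using assms(3) c g unfolding Ed_iff by simp
  thus ?thesis using that[of x "a # y"] c(1) by simp
qed

text \<open>A good path from \<epsilon> back to its own source ends at a persistent vertex; its part
  up to the first such vertex is the required edge.\<close>

lemma Ed_from:
  assumes "\<epsilon> \<in> good_edges" "P (gsrc S' \<epsilon>)" obtains p where "p \<in> Ed" "hd p = \<epsilon>"
proof -
  obtain \<delta> where d: "\<delta> \<in> good_edges" "gtgt S' \<delta> = gsrc S' \<epsilon>" using good_in_edge assms(1) .
  obtain c where "gpath (\<epsilon> # c @ [\<delta>])" using gpath_between assms(1) d(1) .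
  then obtain p c' where "\<epsilon> # c @ [\<delta>] = p @ c'" "p \<in> Ed"
    using gpath_split_first[of "\<epsilon> # c @ [\<delta>]"] assms(2) d by auto
  thus ?thesis using that[of p] Ed_nonempty(1)[of p] by (metis hd_append2 list.sel(1))
qed

lemma Ed_to:
  assumes "\<epsilon> \<in> good_edges" "P (gtgt S' \<epsilon>)" obtains p where "p \<in> Ed" "last p = \<epsilon>"
proof -
  obtain \<delta> where d: "\<delta> \<in> good_edges" "gsrc S' \<delta> = gtgt S' \<epsilon>" using good_out_edge assms(1) .
  obtain c where "gpath (\<delta> # c @ [\<epsilon>])" using gpath_between d(1) assms(1) .
  then obtain p c' where p: "\<delta> # c @ [\<epsilon>] = c' @ p" "p \<in> Ed"
    using gpath_split_last[of "\<delta> # c @ [\<epsilon>]"] assms(2) d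
    by (metis last_ConsR last_snoc list.sel(1) snoc_eq_iff_butlast)
  have "last (\<delta> # c @ [\<epsilon>]) = \<epsilon>" by simp
  thus ?thesis using that[of p] Ed_nonempty(1)[of p] p by (metis last_appendR)
qed

lemma Ed_decomposition:
  assumes "gpath c" "P (gsrc S' (hd c))" "P (gtgt S' (last c))"
  shows "\<exists>ps. is_path T ps \<and> concat ps = c"
  using assms
proof (induction c rule: length_induct)
  case (1 c)
  obtain p c' where c: "c = p @ c'" "p \<in> Ed" using gpath_split_first "1.prems" .
  note pne = Ed_nonempty(1)[OF c(2)]
  show ?case
  proof (cases "c' = []")
    case True
    thus ?thesis using c by (intro exI[of _ "[p]"]) (simp add: is_path_single)
  next
    case False
    hence g: "gpath c'" "gtgt S' (last p) = gsrc S' (hd c')" using "1.prems"(1) gpath_append pne c(1) by auto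
    moreover have "P (gsrc S' (hd c'))" using g(2) Ed_tgt[OF c(2)] by simp
    moreover have "P (gtgt S' (last c'))" "length c' < length c" using "1.prems"(3) c(1) False pne by auto
    ultimately obtain ps where ps: "is_path T ps" "concat ps = c'" using "1.IH" by blast
    have "[] \<notin> set ps" "ps \<noteq> []" using ps(1) Ed_nonempty(2) by (auto simp: is_path_def)
    hence "gsrc S' (hd (hd ps)) = gtgt S' (last p)" using hd_concat ps(2) g(2) by metis
    thus ?thesis using ps c by (intro exI[of _ "p # ps"]) (simp add: is_path_Cons)
  qed
qed

lemma T_path_Ed: "is_path T ps \<Longrightarrow> set ps \<subseteq> Ed" "is_path T ps \<Longrightarrow> [] \<notin> set ps" "is_path T ps \<Longrightarrow> ps \<noteq> []"
  using Ed_nonempty(2) by (auto simp: is_path_def)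

lemma T_path_ends:
  assumes "is_path T ps"
  shows "hd (concat ps) = hd (hd ps)" "last (concat ps) = last (last ps)" "concat ps \<noteq> []"
  using hd_concat[of ps] last_concat[of ps] T_path_Ed(2,3)[OF assms] by simp_all
    (cases ps; auto)

lemma T_path_concat: "is_path T ps \<Longrightarrow> gpath (concat ps)"
proof (induction ps)
  case (Cons p ps)
  have p: "p \<in> Ed" using Cons.prems by (simp add: is_path_Cons)
  show ?case
  proof (cases "ps = []")
    case True
    thus ?thesis using p Ed_gpath by simp
  next
    case False
    hence ps: "is_path T ps" "gtgt S' (last p) = gsrc S' (hd (hd ps))" using Cons.prems by (auto simp: is_path_Cons)
    thus ?thesis using Cons.IH T_path_ends[OF ps(1)] Ed_gpath[OF p] Ed_nonempty(1)[OF p]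
      by (simp add: gpath_append)
  qed
qed (simp add: is_path_def)

section \<open>Vertex kinds and strong connectivity of S''\<close>

lemma T_distr:
  assumes "P u" "distr S' u" shows "distr T u"
proof -
  obtain \<epsilon> \<delta> where e: "\<epsilon> \<in> good_edges" "\<delta> \<in> good_edges" "gsrc S' \<epsilon> = u" "gsrc S' \<delta> = u" "\<epsilon> \<noteq> \<delta>"
    using persistent_distr_out assms .
  obtain p q where "p \<in> Ed" "hd p = \<epsilon>" "q \<in> Ed" "hd q = \<delta>" using e assms(1) Ed_from by metis
  hence "p \<in> {p \<in> Ed. gsrc S' (hd p) = u}" "q \<in> {p \<in> Ed. gsrc S' (hd p) = u}" "p \<noteq> q" using e by auto
  moreover have "finite {p \<in> Ed. gsrc S' (hd p) = u}" using finite_Ed by simp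
  ultimately have "2 \<le> card {p \<in> Ed. gsrc S' (hd p) = u}" by (subst card_ge2_iff) blast+
  moreover obtain \<gamma> where g: "\<gamma> \<in> good_edges" "gtgt S' \<gamma> = u" using persistent_in_edge assms(1) .
  obtain r where r: "r \<in> Ed" "last r = \<gamma>" using Ed_to g assms(1) by metis
  have "{p \<in> Ed. gtgt S' (last p) = u} = {r}"
  proof safe
    fix p assume p: "p \<in> Ed" "u = gtgt S' (last p)"
    have "last p \<in> gedges S'" using Ed_gpath[OF p(1)] by (auto simp: gpath_def is_path_def)
    hence "last p = last r" using distr_in_unique[OF assms(2)] p(2) r g good_edge by metis
    thus "p = r" using Ed_last_inj p(1) r(1) by blast
  qed (use r g in auto)
  ultimately show ?thesis by (simp add: distr_def indeg_def outdeg_def)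
qed

lemma T_coll:
  assumes "P u" "coll S' u" shows "coll T u"
proof -
  obtain \<epsilon> \<delta> where e: "\<epsilon> \<in> good_edges" "\<delta> \<in> good_edges" "gtgt S' \<epsilon> = u" "gtgt S' \<delta> = u" "\<epsilon> \<noteq> \<delta>"
    using persistent_coll_in assms .
  obtain p q where "p \<in> Ed" "last p = \<epsilon>" "q \<in> Ed" "last q = \<delta>" using e assms(1) Ed_to by metis
  hence "p \<in> {p \<in> Ed. gtgt S' (last p) = u}" "q \<in> {p \<in> Ed. gtgt S' (last p) = u}" "p \<noteq> q" using e by auto
  moreover have "finite {p \<in> Ed. gtgt S' (last p) = u}" using finite_Ed by simp
  ultimately have "2 \<le> card {p \<in> Ed. gtgt S' (last p) = u}" by (subst card_ge2_iff) blast+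
  moreover obtain \<gamma> where g: "\<gamma> \<in> good_edges" "gsrc S' \<gamma> = u" using persistent_out_edge assms(1) .
  obtain r where r: "r \<in> Ed" "hd r = \<gamma>" using Ed_from g assms(1) by metis
  have "{p \<in> Ed. gsrc S' (hd p) = u} = {r}"
  proof safe
    fix p assume p: "p \<in> Ed" "u = gsrc S' (hd p)"
    have "hd p \<in> gedges S'" using Ed_gpath[OF p(1)] by (auto simp: gpath_def is_path_def)
    hence "hd p = hd r" using coll_out_unique[OF assms(2)] p(2) r g good_edge by metis
    thus "p = r" using Ed_hd_inj p(1) r(1) by blast
  qed (use r g in auto)
  ultimately show ?thesis by (simp add: coll_def indeg_def outdeg_def)
qed

lemma T_distr_iff: "P u \<Longrightarrow> distr T u \<longleftrightarrow> distr S' u"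
  and T_coll_iff: "P u \<Longrightarrow> coll T u \<longleftrightarrow> coll S' u"
  using T_distr T_coll S1_distr_or_coll persistent_vert not_distr_coll by metis+

lemma T_strongly_connected: "strongly_connected T"
  unfolding strongly_connected_def
proof (intro ballI)
  fix u w assume "u \<in> gverts T" "w \<in> gverts T"
  hence u: "P u" and w: "P w" by auto
  obtain \<epsilon> where e: "\<epsilon> \<in> good_edges" "gsrc S' \<epsilon> = u" using persistent_out_edge u .
  obtain \<delta> where d: "\<delta> \<in> good_edges" "gtgt S' \<delta> = w" using persistent_in_edge w .
  obtain c where "gpath (\<epsilon> # c @ [\<delta>])" using gpath_between e(1) d(1) .
  then obtain ps where ps: "is_path T ps" "concat ps = \<epsilon> # c @ [\<delta>]"
    using Ed_decomposition[of "\<epsilon> # c @ [\<delta>]"] e d u w by auto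
  have "hd (concat ps) = \<epsilon>" "last (concat ps) = \<delta>" using ps(2) by simp_all
  thus "(u, w) \<in> (adj T)\<^sup>*" using path_adj_rtrancl[OF ps(1)] T_path_ends[OF ps(1)] e d by simp
qed

lemma S2_strongly_connected: "strongly_connected S''"
  using T_strongly_connected by (simp add: strongly_connected_def S2_T)

text \<open>Each vertex of S'' is distributing or collecting and so has an in-degree or out-degree
  above 1; the cycle case is exactly the case in which no vertex persists.\<close>

lemma cycle_no_persistent:
  assumes "is_cycle S''" shows "\<not> P u"
proof
  assume "P u"
  hence "distr T u \<or> coll T u" using S1_distr_or_coll persistent_vert T_distr T_coll by blast
  moreover have "indeg T u = 1" "outdeg T u = 1" using assms \<open>P u\<close> by (auto simp: is_cycle_def S2_T)
  ultimately show False by (auto simp: distr_def coll_def)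
qed

section \<open>Natural extensions\<close>

text \<open>The natural right extension of an edge of $S''$ is, read in $S'$, the forced continuation of
  its first edge up to the next branching vertex.\<close>

definition branching :: "('v, 'e) vx \<Rightarrow> bool" where
  "branching u \<longleftrightarrow> P u \<and> distr S' u"

definition merging :: "('v, 'e) vx \<Rightarrow> bool" where
  "merging u \<longleftrightarrow> P u \<and> coll S' u"

lemma nonbranching_out_unique:
  assumes "\<not> branching u" "\<epsilon> \<in> good_edges" "\<delta> \<in> good_edges" "gsrc S' \<epsilon> = u" "gsrc S' \<delta> = u"
  shows "\<epsilon> = \<delta>"
proof (cases "P u")
  case True
  hence "coll S' u" using assms(1) S1_distr_or_coll persistent_vert by (auto simp: branching_def)
  thus ?thesis using coll_out_unique assms good_edge by metis
qed (use nonpersistent_out_unique assms in metis)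

lemma nonmerging_in_unique:
  assumes "\<not> merging u" "\<epsilon> \<in> good_edges" "\<delta> \<in> good_edges" "gtgt S' \<epsilon> = u" "gtgt S' \<delta> = u"
  shows "\<epsilon> = \<delta>"
proof (cases "P u")
  case True
  hence "distr S' u" using assms(1) S1_distr_or_coll persistent_vert by (auto simp: merging_def)
  thus ?thesis using distr_in_unique assms good_edge by metis
qed (use nonpersistent_in_unique assms in metis)

lemma Ed_end_edges:
  assumes "p \<in> Ed" shows "hd p \<in> good_edges" "last p \<in> good_edges"
  using gpath_good[OF Ed_gpath[OF assms]] Ed_nonempty(1)[OF assms] by auto

lemma Ed_ends_in: "p \<in> Ed \<Longrightarrow> gsrc T p \<in> gverts T" "p \<in> Ed \<Longrightarrow> gtgt T p \<in> gverts T"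
  using Ed_src Ed_tgt by auto

text \<open>In-degrees and out-degrees have the same sum, the number of edges, whereas vertices of
  one kind only would make one sum strictly larger. Both kinds are wanted so that natural extensions
  exist in both directions.\<close>

lemma branching_merging_exist:
  assumes "P u"
  obtains b m where "branching b" "merging m"
proof -
  let ?V = "{u. P u}"
  have fin: "finite ?V" by (rule finite_subset[OF _ finite_S1_verts]) (auto simp: persistent_vert)
  have out: "(\<Sum>u\<in>?V. outdeg T u) = card Ed"
    using sum.group[OF finite_Ed fin, of "gsrc T" "\<lambda>_. 1::nat"] Ed_ends_in(1)
    by (simp add: outdeg_def image_subset_iff)
  have inn: "(\<Sum>u\<in>?V. indeg T u) = card Ed"
    using sum.group[OF finite_Ed fin, of "gtgt T" "\<lambda>_. 1::nat"] Ed_ends_in(2)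
    by (simp add: indeg_def image_subset_iff)
  have kinds: "distr T w \<or> coll T w" if "P w" for w
    using that S1_distr_or_coll persistent_vert T_distr T_coll by blast
  have "\<exists>b. branching b"
  proof (rule ccontr)
    assume "\<not> ?thesis"
    hence "coll T w" if "P w" for w using kinds[OF that] T_distr_iff[OF that] that by (auto simp: branching_def)
    hence "outdeg T w < indeg T w" if "P w" for w using that by (simp add: coll_def)
    hence "(\<Sum>u\<in>?V. outdeg T u) < (\<Sum>u\<in>?V. indeg T u)" using assms fin by (intro sum_strict_mono) auto
    thus False using out inn by simp
  qed
  moreover have "\<exists>m. merging m"
  proof (rule ccontr)
    assume "\<not> ?thesis"
    hence "distr T w" if "P w" for w using kinds[OF that] T_coll_iff[OF that] that by (auto simp: merging_def)
    hence "indeg T w < outdeg T w" if "P w" for w using that by (simp add: distr_def)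
    hence "(\<Sum>u\<in>?V. indeg T u) < (\<Sum>u\<in>?V. outdeg T u)" using assms fin by (intro sum_strict_mono) auto
    thus False using out inn by simp
  qed
  ultimately show ?thesis using that by blast
qed

text \<open>Some path from \<open>E\<close> reaches the distributing vertex \<open>b\<close>, so the
  choice in \<open>nat_rext\<close> is a genuine minimum; minimality excludes distributing vertices
  on the way.\<close>

lemma nat_rext_props:
  assumes E: "E \<in> Ed" and b: "branching b"
  defines "r \<equiv> nat_rext T [E]"
  shows "is_path T r" "hd r = E" "distr T (gtgt T (last r))"
    "\<And>q. q \<in> set (butlast r) \<Longrightarrow> \<not> distr T (gtgt T q)"
proof -
  let ?R = "\<lambda>p. is_path T p \<and> take (length [E]) p = [E] \<and> distr T (gtgt T (last p)) \<and>
     (\<forall>q. is_path T q \<and> take (length [E]) q = [E] \<and> distr T (gtgt T (last q)) \<longrightarrow> length p \<le> length q)"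
  let ?Q = "\<lambda>p. is_path T p \<and> take (length [E]) p = [E] \<and> distr T (gtgt T (last p))"
  have pb: "P b" "distr S' b" using b by (auto simp: branching_def)
  have hE: "hd E \<in> good_edges" using Ed_end_edges[OF E] by blast
  obtain \<delta> where d: "\<delta> \<in> good_edges" "gtgt S' \<delta> = b" using persistent_in_edge pb(1) .
  obtain c where c: "gpath (hd E # c @ [\<delta>])" using gpath_between hE d(1) .
  then obtain ps where ps: "is_path T ps" "concat ps = hd E # c @ [\<delta>]"
    using Ed_decomposition[of "hd E # c @ [\<delta>]"] d pb Ed_src[OF E] by auto
  have "hd (hd ps) = hd E" "last (last ps) = \<delta>" using T_path_ends[OF ps(1)] ps(2) by simp_all
  moreover have "hd ps \<in> Ed" using T_path_Ed[OF ps(1)] by auto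
  ultimately have "hd ps = E" "distr T (gtgt T (last ps))" using Ed_hd_inj E T_distr pb d by auto
  hence "?Q ps" using ps(1) T_path_Ed(3)[OF ps(1)] by (cases ps) auto
  then obtain p where "?R p" using ex_has_least_nat[of ?Q ps length] by blast
  hence R: "?R r" unfolding r_def nat_rext_def by (rule someI)
  show path: "is_path T r" and hd: "hd r = E" and "distr T (gtgt T (last r))"
    using R by (auto, cases r) auto
  fix q assume "q \<in> set (butlast r)"
  then obtain x y where "butlast r = x @ q # y" by (metis split_list)
  hence r: "r = (x @ [q]) @ (y @ [last r])" using path
    by (metis append.assoc append_Cons append_Nil append_butlast_last_id is_path_nonempty)
  hence "is_path T (x @ [q])" using is_path_append[of "x @ [q]" "y @ [last r]" T] path by simp
  moreover have "hd (x @ [q]) = E" using hd by (subst (asm) r) (cases x; simp)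
  hence "take (length [E]) (x @ [q]) = [E]" by (cases x) auto
  moreover have "length (x @ [q]) < length r" by (subst r) simp
  ultimately show "\<not> distr T (gtgt T q)" using R by (metis last_snoc not_le)
qed

lemma nat_lext_props:
  assumes E: "E \<in> Ed" and m: "merging m"
  defines "l \<equiv> nat_lext T [E]"
  shows "is_path T l" "last l = E" "coll T (gsrc T (hd l))"
    "\<And>q. q \<in> set (tl l) \<Longrightarrow> \<not> coll T (gsrc T q)"
proof -
  let ?R = "\<lambda>p. is_path T p \<and> drop (length p - length [E]) p = [E] \<and> length [E] \<le> length p \<and> coll T (gsrc T (hd p)) \<and>
     (\<forall>q. is_path T q \<and> drop (length q - length [E]) q = [E] \<and> length [E] \<le> length q \<and> coll T (gsrc T (hd q)) \<longrightarrow> length p \<le> length q)"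
  let ?Q = "\<lambda>p. is_path T p \<and> drop (length p - length [E]) p = [E] \<and> length [E] \<le> length p \<and> coll T (gsrc T (hd p))"
  have Qs: "drop (length p - length [E]) p = [E] \<and> length [E] \<le> length p \<longleftrightarrow> p \<noteq> [] \<and> last p = E" for p
    by (cases p rule: rev_cases) auto
  have pm: "P m" "coll S' m" using m by (auto simp: merging_def)
  have lE: "last E \<in> good_edges" using Ed_end_edges[OF E] by blast
  obtain \<delta> where d: "\<delta> \<in> good_edges" "gsrc S' \<delta> = m" using persistent_out_edge pm(1) .
  obtain c where c: "gpath (\<delta> # c @ [last E])" using gpath_between d(1) lE .
  then obtain ps where ps: "is_path T ps" "concat ps = \<delta> # c @ [last E]"
    using Ed_decomposition[of "\<delta> # c @ [last E]"] d pm Ed_tgt[OF E] by auto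
  have "hd (concat ps) = \<delta>" "last (concat ps) = last E" using ps(2) by simp_all
  hence "last (last ps) = last E" "hd (hd ps) = \<delta>" using T_path_ends[OF ps(1)] by simp_all
  moreover have "last ps \<in> Ed" using T_path_Ed[OF ps(1)] by auto
  ultimately have "last ps = E" "coll T (gsrc T (hd ps))" using Ed_last_inj E T_coll pm d by auto
  hence "?Q ps" using ps(1) T_path_Ed(3)[OF ps(1)] Qs by blast
  then obtain p where "?R p" using ex_has_least_nat[of ?Q ps length] by blast
  hence R: "?R l" unfolding l_def nat_lext_def by (rule someI)
  show path: "is_path T l" and last: "last l = E" and "coll T (gsrc T (hd l))"
    using R Qs by blast+
  fix q assume "q \<in> set (tl l)"
  then obtain x y where "tl l = x @ q # y" by (metis split_list)
  hence l: "l = (hd l # x) @ (q # y)" using path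
    by (metis append_Cons hd_Cons_tl is_path_nonempty)
  hence "is_path T (q # y)" using is_path_append[of "hd l # x" "q # y" T] path by simp
  moreover have "last (q # y) = E" using last by (subst (asm) l) simp
  moreover have "length (q # y) < length l" by (subst l) simp
  ultimately show "\<not> coll T (gsrc T q)" using R Qs by (metis list.distinct(1) list.sel(1) not_le)
qed

lemma rext_concat:
  assumes E: "E \<in> Ed" and b: "branching b"
  defines "R \<equiv> concat (nat_rext T [E])"
  shows "gpath R" "hd R = hd E" "branching (gtgt S' (last R))" "\<And>a. a \<in> set (butlast R) \<Longrightarrow> \<not> branching (gtgt S' a)"
proof -
  note r = nat_rext_props[OF E b]
  note ends = T_path_ends[OF r(1)] and Eds = T_path_Ed[OF r(1)]
  show "gpath R" "hd R = hd E" using T_path_concat[OF r(1)] ends r(2) by (auto simp: R_def)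
  have "last (nat_rext T [E]) \<in> Ed" using Eds by auto
  thus "branching (gtgt S' (last R))" using r(3) ends(2) Ed_tgt T_distr_iff by (simp add: R_def branching_def)
  fix a assume "a \<in> set (butlast R)"
  then consider p where "p \<in> set (nat_rext T [E])" "a \<in> set (butlast p)"
    | p where "p \<in> set (butlast (nat_rext T [E]))" "a = last p"
    using in_butlast_concat[OF Eds(2)] unfolding R_def by blast
  thus "\<not> branching (gtgt S' a)"
  proof cases
    case 1
    thus ?thesis using Eds(1) Ed_inner_tgt by (auto simp: branching_def)
  next
    case 2
    thus ?thesis using r(4)[OF 2(1)] T_distr by (auto simp: branching_def)
  qed
qed

lemma lext_concat:
  assumes E: "E \<in> Ed" and m: "merging m"
  defines "L \<equiv> concat (nat_lext T [E])"
  shows "gpath L" "last L = last E" "merging (gsrc S' (hd L))" "\<And>a. a \<in> set (tl L) \<Longrightarrow> \<not> merging (gsrc S' a)"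
proof -
  note l = nat_lext_props[OF E m]
  note ends = T_path_ends[OF l(1)] and Eds = T_path_Ed[OF l(1)]
  show "gpath L" "last L = last E" using T_path_concat[OF l(1)] ends l(2) by (auto simp: L_def)
  have "hd (nat_lext T [E]) \<in> Ed" using Eds by auto
  thus "merging (gsrc S' (hd L))" using l(3) ends(1) Ed_src T_coll_iff by (simp add: L_def merging_def)
  fix a assume "a \<in> set (tl L)"
  then consider p where "p \<in> set (nat_lext T [E])" "a \<in> set (tl p)"
    | p where "p \<in> set (tl (nat_lext T [E]))" "a = hd p"
    using in_tl_concat[OF Eds(2)] unfolding L_def by blast
  thus "\<not> merging (gsrc S' a)"
  proof cases
    case 1
    thus ?thesis using Eds(1) Ed_inner_src by (auto simp: merging_def)
  next
    case 2
    thus ?thesis using l(4)[OF 2(1)] T_coll by (auto simp: merging_def)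
  qed
qed

text \<open>Split off the natural extension \<open>r\<close> of the first edge. Its later edges
  start at collecting vertices and add nothing in S'', while the front word of the first edge was
  defined as F of all of \<open>concat r\<close>. The rest starts at a distributing vertex, where a
  first edge counts like any other, so the words glue in the same way in S'' and S'.\<close>

lemma S2_Fw:
  assumes "is_path T ps" "distr T (gtgt T (last ps))"
  shows "Fw S'' ps = Fw S' (concat ps)"
  using assms
proof (induction ps rule: length_induct)
  case (1 ps)
  note path = "1.prems"(1)
  have E: "hd ps \<in> Ed" "last ps \<in> Ed" "ps \<noteq> []" using T_path_Ed[OF path] by auto
  have b: "branching (gtgt S' (last (last ps)))"
    using "1.prems"(2) Ed_tgt[OF E(2)] T_distr_iff by (simp add: branching_def)
  define r where "r = nat_rext T [hd ps]"
  note r = nat_rext_props[OF E(1) b, folded r_def]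
  have rE: "set r \<subseteq> Ed" "r \<noteq> []" using T_path_Ed[OF r(1)] by auto
  have "prefix r ps \<or> prefix ps r"
  proof (rule path_determined[OF r(1) path rE(1) T_path_Ed(1)[OF path] r(2)])
    fix a e f assume a: "a \<in> set (butlast r)" "e \<in> Ed" "f \<in> Ed" "gsrc T e = gtgt T a" "gsrc T f = gtgt T a"
    have "P (gtgt T a)" using Ed_src[OF a(2)] a(4) by simp
    hence "coll T (gtgt T a)"
      using r(4)[OF a(1)] T_distr T_coll S1_distr_or_coll persistent_vert by metis
    thus "e = f" using coll_out_unique[of T "gtgt T a" e f] a by simp
  qed
  \<comment> \<open>\<open>ps\<close> ends at a distributing vertex and \<open>r\<close> stops at
    the first one it meets, so \<open>ps\<close> is at least as long.\<close>
  moreover have "\<not> (prefix ps r \<and> ps \<noteq> r)"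
    using prefix_last_in_butlast[of ps r] r(4) "1.prems"(2) E(3) by blast
  ultimately obtain ps' where ps': "ps = r @ ps'" by (auto simp: prefix_def)
  have "gF S'' q = []" if "q \<in> set (tl r)" for q
  proof -
    have "gsrc T q \<in> gtgt T ` set (butlast r)" using path_inner_vertices[OF r(1)] that by simp
    thus ?thesis using r(4) by (auto simp: gF_def S2_T)
  qed
  hence "Fw S'' (hd r # tl r) = gfw S'' (hd r)" unfolding Fw_Cons by simp
  hence "Fw S'' r = gfw S'' (hd ps)" using list.collapse[OF rE(2)] r(2) by metis
  also have "\<dots> = Fw S' (concat r)" by (simp add: r_def)
  finally have Fr: "Fw S'' r = Fw S' (concat r)" .
  show ?case
  proof (cases "ps' = []")
    case True
    thus ?thesis using Fr ps' by simp
  next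
    case False
    have q: "is_path T ps'" "gtgt T (last r) = gsrc T (hd ps')" using path ps' False rE(2) is_path_append[of r ps' T] by auto
    have dT: "distr T (gsrc T (hd ps'))" using r(3) q(2) by simp
    have "hd ps' \<in> Ed" using T_path_Ed[OF q(1)] by auto
    hence dS: "distr S' (gsrc S' (hd (concat ps')))" using dT T_distr_iff Ed_src T_path_ends(1)[OF q(1)] by simp
    have "length ps' < length ps" "last ps' = last ps" using ps' rE(2) False by auto
    hence IH: "Fw S'' ps' = Fw S' (concat ps')" using "1.IH" q(1) "1.prems"(2) by simp
    have "Fw S'' ps = Fw S'' r @ FF S'' ps'" unfolding ps' by (rule Fw_append[OF rE(2)])
    also have "FF S'' ps' = Fw S'' ps'" using Fw_FF[of ps' S''] False dT by (simp add: S2_T)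
    also have "Fw S'' ps' = FF S' (concat ps')" unfolding IH by (rule Fw_FF[OF T_path_ends(3)[OF q(1)] dS])
    also have "Fw S'' r @ FF S' (concat ps') = Fw S' (concat r @ concat ps')"
      using Fw_append[OF T_path_ends(3)[OF r(1)]] Fr by metis
    finally show ?thesis by (simp add: ps')
  qed
qed

lemma S2_Bw:
  assumes "is_path T ps" "coll T (gsrc T (hd ps))"
  shows "Bw S'' ps = Bw S' (concat ps)"
  using assms
proof (induction ps rule: length_induct)
  case (1 ps)
  note path = "1.prems"(1)
  have E: "last ps \<in> Ed" "hd ps \<in> Ed" "ps \<noteq> []" using T_path_Ed[OF path] by auto
  have m: "merging (gsrc S' (hd (hd ps)))"
    using "1.prems"(2) Ed_src[OF E(2)] T_coll_iff by (simp add: merging_def)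
  define l where "l = nat_lext T [last ps]"
  note l = nat_lext_props[OF E(1) m, folded l_def]
  have lE: "set l \<subseteq> Ed" "l \<noteq> []" using T_path_Ed[OF l(1)] by auto
  have "suffix l ps \<or> suffix ps l"
  proof (rule path_determined_backward[OF l(1) path lE(1) T_path_Ed(1)[OF path] l(2)])
    fix a e f assume a: "a \<in> set (tl l)" "e \<in> Ed" "f \<in> Ed" "gtgt T e = gsrc T a" "gtgt T f = gsrc T a"
    have "P (gsrc T a)" using a(2) Ed_tgt[OF a(2)] a(4) by simp
    hence "distr T (gsrc T a)"
      using l(4)[OF a(1)] T_distr T_coll S1_distr_or_coll persistent_vert by metis
    thus "e = f" using distr_in_unique[of T "gsrc T a" e f] a by simp
  qed
  moreover have "\<not> (suffix ps l \<and> ps \<noteq> l)"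
    using suffix_hd_in_tl[of ps l] l(4) "1.prems"(2) E(3) by blast
  ultimately obtain ps' where ps': "ps = ps' @ l" by (auto simp: suffix_def)
  have "gB S'' q = []" if "q \<in> set (butlast l)" for q
  proof -
    have "gtgt T q \<in> gsrc T ` set (tl l)" using path_inner_vertices[OF l(1)] that by auto
    thus ?thesis using l(4) by (auto simp: gB_def S2_T)
  qed
  hence "Bw S'' (butlast l @ [last l]) = gbw S'' (last l)" unfolding Bw_snoc by simp
  hence "Bw S'' l = gbw S'' (last ps)" using append_butlast_last_id[OF lE(2)] l(2) by metis
  also have "\<dots> = Bw S' (concat l)" by (simp add: l_def)
  finally have Bl: "Bw S'' l = Bw S' (concat l)" .
  show ?case
  proof (cases "ps' = []")
    case True
    thus ?thesis using Bl ps' by simp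
  next
    case False
    have q: "is_path T ps'" "gtgt T (last ps') = gsrc T (hd l)" using path ps' False lE(2) is_path_append[of ps' l T] by auto
    have dT: "coll T (gtgt T (last ps'))" using l(3) q(2) by simp
    have "last ps' \<in> Ed" using T_path_Ed[OF q(1)] by auto
    hence dS: "coll S' (gtgt S' (last (concat ps')))" using dT T_coll_iff Ed_tgt T_path_ends(2)[OF q(1)] by simp
    have "length ps' < length ps" "hd ps' = hd ps" using ps' lE(2) False by auto
    hence IH: "Bw S'' ps' = Bw S' (concat ps')" using "1.IH" q(1) "1.prems"(2) by simp
    have "Bw S'' ps = BB S'' ps' @ Bw S'' l" unfolding ps' by (rule Bw_append[OF lE(2)])
    also have "BB S'' ps' = Bw S'' ps'" using Bw_BB[of ps' S''] False dT by (simp add: S2_T)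
    also have "Bw S'' ps' = BB S' (concat ps')" unfolding IH by (rule Bw_BB[OF T_path_ends(3)[OF q(1)] dS])
    also have "BB S' (concat ps') @ Bw S'' l = Bw S' (concat ps' @ concat l)"
      using Bw_append[OF T_path_ends(3)[OF l(1)]] Bl by metis
    finally show ?thesis by (simp add: ps')
  qed
qed

section \<open>Edge words of S'' as factors of \<open>W\<close>\<close>

lemma S1_Fw_infix:
  "symmetric_path S' (l @ s @ r) \<Longrightarrow> symmetric_path S' s \<Longrightarrow> Fw S' (l @ s @ r) = BB S' l @ Fw S' s @ FF S' r"
  using Fw_symmetric_infix S1_Fw_eq_Bw by metis

text \<open>If \<open>R\<close> starts at a distributing vertex, its first front word counts in the
  larger path as well; otherwise \<open>R\<close> starts at a collecting vertex, is symmetric, and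
  \<open>S1_Fw_infix\<close> applies.\<close>

lemma S1_infix_Fw_factor:
  assumes s: "symmetric_path S' (l @ R @ r)" "factor (Fw S' (l @ R @ r)) W"
    and R: "gpath R" "distr S' (gtgt S' (last R))"
  shows "factor (Fw S' R) W"
proof -
  have ne: "R \<noteq> []" using R(1) gpath_nonempty by blast
  have "sublist (Fw S' R) (Fw S' (l @ R @ r))"
  proof (cases "distr S' (gsrc S' (hd R))")
    case True
    show ?thesis
    proof (cases "l = []")
      case False
      hence "Fw S' (l @ R @ r) = Fw S' l @ FF S' R @ FF S' r" by (simp add: Fw_append)
      thus ?thesis using Fw_FF[OF ne True] by simp
    qed (simp add: Fw_append ne)
  next
    case False
    have "hd R \<in> gedges S'" using gpath_path[OF R(1)] ne by (auto simp: is_path_def)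
    hence "symmetric_path S' R" using False R S1_distr_or_coll S1_src_vert
      by (auto simp: symmetric_path_def gpath_def)
    thus ?thesis using S1_Fw_infix s(1) by simp
  qed
  thus ?thesis using factor_mono s(2) by blast
qed

lemma S1_infix_Bw_factor:
  assumes s: "symmetric_path S' (l @ L @ r)" "factor (Fw S' (l @ L @ r)) W"
    and L: "gpath L" "coll S' (gsrc S' (hd L))"
  shows "factor (Bw S' L) W"
proof -
  have ne: "L \<noteq> []" using L(1) gpath_nonempty by blast
  have "sublist (Bw S' L) (Bw S' (l @ L @ r))"
  proof (cases "coll S' (gtgt S' (last L))")
    case True
    show ?thesis
    proof (cases "r = []")
      case False
      hence "Bw S' ((l @ L) @ r) = (BB S' l @ BB S' L) @ Bw S' r" by (subst Bw_append) auto
      thus ?thesis using Bw_BB[OF ne True] by simp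
    qed (simp add: Bw_append ne)
  next
    case False
    have "last L \<in> gedges S'" using gpath_path[OF L(1)] ne by (auto simp: is_path_def)
    hence "symmetric_path S' L" using False L S1_distr_or_coll S1_tgt_vert
      by (auto simp: symmetric_path_def gpath_def)
    hence "Fw S' (l @ L @ r) = BB S' l @ Bw S' L @ FF S' r" using S1_Fw_infix[OF s(1)] S1_Fw_eq_Bw[of L] by simp
    thus ?thesis unfolding S1_Fw_eq_Bw[OF s(1), symmetric] sublist_def by blast
  qed
  moreover have "factor (Bw S' (l @ L @ r)) W" using s(2) unfolding S1_Fw_eq_Bw[OF s(1)] .
  ultimately show ?thesis using factor_mono by blast
qed

text \<open>A path of good edges from the first edge of the extension to an edge leaving its end
  must begin with the whole extension, since there is no choice on the way.\<close>

lemma S2_gfw_factor: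
  assumes E: "E \<in> Ed" and b: "branching b"
  shows "factor (gfw S'' E) W"
proof -
  define R where "R = concat (nat_rext T [E])"
  note R = rext_concat[OF E b, folded R_def]
  have h: "hd R \<in> good_edges" using gpath_good[OF R(1)] gpath_nonempty[OF R(1)] by auto
  have "P (gtgt S' (last R))" using R(3) by (simp add: branching_def)
  then obtain \<delta> where d: "\<delta> \<in> good_edges" "gsrc S' \<delta> = gtgt S' (last R)" by (rule persistent_out_edge)
  have "factor [] W" by (simp add: factor_def)
  then obtain l p r where s: "symmetric_path S' (l @ (hd R # p @ [\<delta>]) @ r)" "set (l @ (hd R # p @ [\<delta>]) @ r) \<subseteq> good_edges"
    "factor (Fw S' (l @ (hd R # p @ [\<delta>]) @ r)) W"
    using good_path_through[OF h d(1)] by metis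
  let ?c = "hd R # p @ [\<delta>]"
  have c: "is_path S' ?c" using is_path_infix[of S' l ?c r] symmetric_path_is_path[OF s(1)] by simp
  have "prefix R ?c \<or> prefix ?c R"
    using s(2) R(4) nonbranching_out_unique
    by (intro path_determined[OF gpath_path[OF R(1)] c gpath_good[OF R(1)]]) auto
  \<comment> \<open>Otherwise dropping \<delta> leaves a proper prefix of \<open>R\<close> that ends
    at the source of \<delta>, the branching end of \<open>R\<close>; but no interior vertex of
    \<open>R\<close> branches.\<close>
  moreover have "\<not> prefix ?c R"
  proof
    assume "prefix ?c R"
    hence "prefix (hd R # p) R" by (metis append_Cons append_prefixD)
    moreover have "hd R # p \<noteq> R" using prefix_length_le[OF \<open>prefix ?c R\<close>] by (metis impossible_Cons length_Cons length_append_singleton lessI not_le append_Cons)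
    ultimately have "last (hd R # p) \<in> set (butlast R)" using prefix_last_in_butlast by blast
    moreover have "gtgt S' (last (hd R # p)) = gsrc S' \<delta>"
      using c is_path_append[of "hd R # p" "[\<delta>]" S'] by simp
    ultimately show False using R(3,4) d(2) by metis
  qed
  ultimately obtain z where "?c = R @ z" by (auto simp: prefix_def)
  hence "l @ ?c @ r = l @ R @ (z @ r)" by simp
  hence "factor (Fw S' R) W" using S1_infix_Fw_factor[of l R "z @ r"] s R(1,3) by (simp add: branching_def)
  thus ?thesis by (simp add: R_def)
qed

lemma S2_gbw_factor:
  assumes E: "E \<in> Ed" and m: "merging m"
  shows "factor (gbw S'' E) W"
proof -
  define L where "L = concat (nat_lext T [E])"
  note L = lext_concat[OF E m, folded L_def]
  have h: "last L \<in> good_edges" using gpath_good[OF L(1)] gpath_nonempty[OF L(1)] by auto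
  have "P (gsrc S' (hd L))" using L(3) by (simp add: merging_def)
  then obtain \<delta> where d: "\<delta> \<in> good_edges" "gtgt S' \<delta> = gsrc S' (hd L)" by (rule persistent_in_edge)
  have "factor [] W" by (simp add: factor_def)
  then obtain l p r where s: "symmetric_path S' (l @ (\<delta> # p @ [last L]) @ r)" "set (l @ (\<delta> # p @ [last L]) @ r) \<subseteq> good_edges"
    "factor (Fw S' (l @ (\<delta> # p @ [last L]) @ r)) W"
    using good_path_through[OF d(1) h] by metis
  let ?c = "\<delta> # p @ [last L]"
  have c: "is_path S' ?c" using is_path_infix[of S' l ?c r] symmetric_path_is_path[OF s(1)] by simp
  have "suffix L ?c \<or> suffix ?c L"
    using s(2) L(4) nonmerging_in_unique
    by (intro path_determined_backward[OF gpath_path[OF L(1)] c gpath_good[OF L(1)]]) auto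
  moreover have "\<not> suffix ?c L"
  proof
    assume suf: "suffix ?c L"
    hence "suffix (p @ [last L]) L" by (metis suffix_ConsD)
    moreover have "p @ [last L] \<noteq> L"
    proof
      assume "p @ [last L] = L"
      from arg_cong[OF this, of length] show False using suffix_length_le[OF suf] by simp
    qed
    ultimately have "hd (p @ [last L]) \<in> set (tl L)" using suffix_hd_in_tl by blast
    moreover have "gsrc S' (hd (p @ [last L])) = gtgt S' \<delta>"
      using c by (simp add: is_path_Cons)
    ultimately show False using L(3,4) d(2) by metis
  qed
  ultimately obtain z where "?c = z @ L" by (auto simp: suffix_def)
  hence "l @ ?c @ r = (l @ z) @ L @ r" by simp
  hence "factor (Bw S' L) W" using S1_infix_Bw_factor[of "l @ z" L r] s L(1,3) by (simp add: merging_def)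
  thus ?thesis by (simp add: L_def)
qed

section \<open>Conditions (1)--(7)\<close>

lemma S2_symmetric_concat:
  assumes "symmetric_path S'' ps"
  shows "symmetric_path S' (concat ps)" "set (concat ps) \<subseteq> good_edges"
    "Fw S'' ps = Fw S' (concat ps)" "Bw S'' ps = Bw S' (concat ps)" "is_path T ps"
proof -
  show path: "is_path T ps" using assms by (simp add: symmetric_path_def S2_T)
  have k: "coll T (gsrc T (hd ps))" "distr T (gtgt T (last ps))"
    using assms by (auto simp: symmetric_path_def S2_T)
  note g = T_path_concat[OF path]
  have "hd ps \<in> Ed" "last ps \<in> Ed" using T_path_Ed[OF path] by auto
  thus "symmetric_path S' (concat ps)" using k g T_path_ends[OF path] T_coll_iff T_distr_iff Ed_src Ed_tgt
    by (simp add: symmetric_path_def gpath_def)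
  show "set (concat ps) \<subseteq> good_edges" using g gpath_good by blast
  show "Fw S'' ps = Fw S' (concat ps)" "Bw S'' ps = Bw S' (concat ps)"
    using S2_Fw S2_Bw path k by blast+
qed

text \<open>A block has no persistent vertex in its interior, so a cut at a persistent vertex falls
  between two blocks.\<close>

lemma concat_split_at_persistent:
  assumes "set qs \<subseteq> Ed" "concat qs = a @ c" "c \<noteq> []" "P (gsrc S' (hd c))"
  shows "\<exists>qs1 qs2. qs = qs1 @ qs2 \<and> concat qs1 = a \<and> concat qs2 = c"
  using assms
proof (induction qs arbitrary: a)
  case (Cons q qs)
  show ?case
  proof (cases "a = []")
    case True
    thus ?thesis using Cons.prems by (intro exI[of _ "[]"] exI[of _ "q # qs"]) simp
  next
    case False
    have eq: "q @ concat qs = a @ c" using Cons.prems(2) by simp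
    show ?thesis
    proof (cases "length q \<le> length a")
      case True
      obtain a' where a': "a = q @ a'" "concat qs = a' @ c" using append_cut_prefix[OF eq True] .
      then obtain qs1 qs2 where "qs = qs1 @ qs2" "concat qs1 = a'" "concat qs2 = c"
        using Cons.IH[of a'] Cons.prems by auto
      thus ?thesis using a' by (intro exI[of _ "q # qs1"] exI[of _ qs2]) simp
    next
      case longer: False
      obtain z where z: "q = a @ z" "c = z @ concat qs"
        using append_cut_prefix[OF eq[symmetric]] longer by (metis nat_le_linear)
      hence "z \<noteq> []" using longer by auto
      hence "hd c \<in> set (tl q)" using z False by simp
      thus ?thesis using Ed_inner_src[of q "hd c"] Cons.prems(1,4) by simp
    qed
  qed
qed simp

text \<open>Each block is recognised by its first edge, so the blocks can be matched one at a
  time.\<close>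

lemma concat_prefix_determined:
  assumes "set ps \<subseteq> Ed" "set qs \<subseteq> Ed" "concat qs = concat ps @ b"
  shows "\<exists>b'. qs = ps @ b'"
  using assms
proof (induction ps arbitrary: qs)
  case (Cons p ps)
  have ne: "p \<noteq> []" using Cons.prems(1) Ed_nonempty(1) by auto
  then obtain q qs' where qs: "qs = q # qs'" using Cons.prems(3) by (cases qs) auto
  have "q \<noteq> []" using Cons.prems(2) qs Ed_nonempty(1) by auto
  hence "hd q = hd p" using ne Cons.prems(3) qs by (metis concat.simps(2) hd_append2 append_assoc)
  hence "q = p" using Ed_hd_inj Cons.prems(1,2) qs by auto
  thus ?case using Cons.IH[of qs'] Cons.prems qs by auto
qed simp

lemma S2_occ_Fw_le:
  assumes sym: "symmetric_path S'' p1" "symmetric_path S'' p2"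
  shows "occ (Fw S'' p1) (Fw S'' p2) \<le> occ p1 p2"
proof -
  note c1 = S2_symmetric_concat[OF sym(1)] and c2 = S2_symmetric_concat[OF sym(2)]
  have "occ (Fw S'' p1) (Fw S'' p2) \<le> occ (concat p1) (concat p2)"
    unfolding c1(3) c2(3) by (rule S1_occ_Fw_le[OF c1(1) c2(1)])
  also have "\<dots> \<le> occ p1 p2"
  proof (rule occ_le)
    fix a b assume eq: "concat p2 = a @ concat p1 @ b"
    have "hd p1 \<in> Ed" using T_path_Ed[OF c1(5)] by auto
    hence "P (gsrc S' (hd (concat p1 @ b)))" using T_path_ends[OF c1(5)] Ed_src by simp
    then obtain q1 q2 where q: "p2 = q1 @ q2" "concat q1 = a" "concat q2 = concat p1 @ b"
      using concat_split_at_persistent[OF T_path_Ed(1)[OF c2(5)] eq] T_path_ends(3)[OF c1(5)] by auto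
    then obtain b' where "q2 = p1 @ b'"
      using concat_prefix_determined[of p1 q2 b] T_path_Ed(1)[OF c1(5)] T_path_Ed(1)[OF c2(5)] by auto
    thus "\<exists>a' b'. p2 = a' @ p1 @ b' \<and> length (concat a') = length a" using q by auto
  qed
  finally show ?thesis .
qed

text \<open>A path of good edges reading \<open>w\<close> may start or end at vertices that are not
  persistent. Prolonging it by good paths back to \<open>m\<close> and on to \<open>b\<close> makes
  it a concatenation of blocks, symmetric in S'', and its word still occurs inside by
  \<open>S1_Fw_infix\<close>.\<close>

lemma S2_factor_covered:
  assumes w: "factor w W" and b: "branching b" and m: "merging m"
  shows "\<exists>ps. symmetric_path S'' ps \<and> sublist w (Fw S'' ps)"
proof -
  have Pb: "P b" "distr S' b" and Pm: "P m" "coll S' m" using b m by (auto simp: branching_def merging_def)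
  obtain \<delta> where d: "\<delta> \<in> good_edges" "gtgt S' \<delta> = b" using persistent_in_edge Pb(1) .
  obtain \<epsilon> where e: "\<epsilon> \<in> good_edges" "gsrc S' \<epsilon> = m" using persistent_out_edge Pm(1) .
  obtain s where s: "symmetric_path S' s" "set s \<subseteq> good_edges" "sublist w (Fw S' s)"
    using good_path_through[OF e(1) e(1) w] by metis
  have ne: "s \<noteq> []" using s(1) symmetric_path_nonempty by blast
  hence hl: "hd s \<in> good_edges" "last s \<in> good_edges" using s(2) by auto
  obtain p where p: "gpath (\<epsilon> # p @ [hd s])" using gpath_between e(1) hl(1) .
  obtain q where q: "gpath (last s # q @ [\<delta>])" using gpath_between hl(2) d(1) .
  let ?x = "\<epsilon> # p" and ?y = "q @ [\<delta>]"
  have "is_path S' (?x @ hd s # tl s)"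
    using is_path_join[of S' ?x "hd s" "tl s"] p s(1) ne by (simp add: gpath_def symmetric_path_def)
  hence "is_path S' ((?x @ butlast s) @ [last s])" using ne by simp
  hence "is_path S' ((?x @ butlast s) @ last s # ?y)"
    using is_path_join[of S' "?x @ butlast s" "last s" ?y] q by (simp add: gpath_def)
  moreover have "(?x @ butlast s) @ last s # ?y = ?x @ s @ ?y"
    using ne by (metis append_assoc append_Cons append_Nil append_butlast_last_id)
  ultimately have path: "is_path S' (?x @ s @ ?y)" by (simp only:)
  let ?c = "?x @ s @ ?y"
  have g: "gpath ?c" using path p q s(2) by (auto simp: gpath_def)
  have ends: "hd ?c = \<epsilon>" "last ?c = \<delta>" by auto
  have sym: "symmetric_path S' ?c" using path ends d e Pb Pm by (simp add: symmetric_path_def)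
  have "sublist w (Fw S' ?c)"
    unfolding S1_Fw_infix[OF sym s(1)] using s(3) by (auto simp: sublist_def) (metis append_assoc)
  moreover obtain ps where ps: "is_path T ps" "concat ps = ?c"
    using Ed_decomposition[OF g] d e Pb Pm ends by auto
  have "distr T b" "coll T m" using T_distr Pb T_coll Pm by auto
  hence "symmetric_path S'' ps"
    using ps(1) T_path_ends[OF ps(1)] unfolding ps(2) ends using d e by (simp add: symmetric_path_def S2_T)
  ultimately show ?thesis using S2_symmetric_concat(3) ps(2) by metis
qed

text \<open>The marker of the first edge of \<open>E\<close> works: that edge has a persistent
  source, so within a concatenation of blocks it can only be the head of one, and the head
  determines the block.\<close>

lemma S2_marker:
  assumes "E \<in> Ed"
  shows "\<exists>u. factor u W \<and> (\<forall>ps. symmetric_path S'' ps \<and> sublist u (Fw S'' ps) \<longrightarrow> E \<in> set ps)"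
proof -
  have "hd E \<in> good_edges" using Ed_end_edges[OF assms] by blast
  then obtain u where u: "factor u W" "\<And>s. symmetric_path S' s \<Longrightarrow> sublist u (Fw S' s) \<Longrightarrow> hd E \<in> set s"
    using S1_marker by metis
  have "E \<in> set ps" if "symmetric_path S'' ps" "sublist u (Fw S'' ps)" for ps
  proof -
    note c = S2_symmetric_concat[OF that(1)]
    have "hd E \<in> set (concat ps)" using u(2)[OF c(1)] c(3) that(2) by simp
    then obtain p where p: "p \<in> set ps" "hd E \<in> set p" by auto
    hence pE: "p \<in> Ed" using T_path_Ed(1)[OF c(5)] by blast
    have "hd E \<notin> set (tl p)" using Ed_inner_src[OF pE] Ed_src[OF assms] by blast
    hence "hd p = hd E" using p(2) by (cases p) auto
    thus ?thesis using Ed_hd_inj pE assms p(1) by metis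
  qed
  thus ?thesis using u(1) by blast
qed

text \<open>The natural extension of an edge begins with that edge, so its front word begins with
  the front word in S' of its first edge, and distinct edges of S'' have distinct first
  edges.\<close>

lemma S2_fw_distinct:
  assumes b: "branching u" and e: "e1 \<in> Ed" "e2 \<in> Ed" "gsrc S'' e1 = u" "gsrc S'' e2 = u" "e1 \<noteq> e2"
  shows "gfw S'' e1 \<noteq> [] \<and> gfw S'' e2 \<noteq> [] \<and> hd (gfw S'' e1) \<noteq> hd (gfw S'' e2)"
proof -
  have F: "\<exists>z. gfw S'' e = gfw S' (hd e) @ z" if "e \<in> Ed" for e
  proof -
    have "concat (nat_rext T [e]) = hd e # tl (concat (nat_rext T [e]))"
      using rext_concat(1,2)[OF that b] gpath_nonempty by (metis list.collapse)
    thus ?thesis by (metis Fw_Cons T_simps(9))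
  qed
  have "hd e1 \<in> gedges S'" "hd e2 \<in> gedges S'" using e(1,2) Ed_end_edges good_edge by auto
  moreover have "hd e1 \<noteq> hd e2" using Ed_hd_inj e by blast
  ultimately have "gfw S' (hd e1) \<noteq> [] \<and> gfw S' (hd e2) \<noteq> [] \<and> hd (gfw S' (hd e1)) \<noteq> hd (gfw S' (hd e2))"
    using S1_fw_distinct[of "hd e1" "hd e2"] b e(3,4) by (simp add: branching_def)
  moreover obtain z1 z2 where "gfw S'' e1 = gfw S' (hd e1) @ z1" "gfw S'' e2 = gfw S' (hd e2) @ z2"
    using F e(1,2) by metis
  ultimately show ?thesis by simp
qed

lemma S2_bw_distinct:
  assumes m: "merging u" and e: "e1 \<in> Ed" "e2 \<in> Ed" "gtgt S'' e1 = u" "gtgt S'' e2 = u" "e1 \<noteq> e2"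
  shows "gbw S'' e1 \<noteq> [] \<and> gbw S'' e2 \<noteq> [] \<and> last (gbw S'' e1) \<noteq> last (gbw S'' e2)"
proof -
  have F: "\<exists>z. gbw S'' e = z @ gbw S' (last e)" if "e \<in> Ed" for e
  proof -
    have "concat (nat_lext T [e]) = butlast (concat (nat_lext T [e])) @ [last e]"
      using lext_concat(1,2)[OF that m] gpath_nonempty by (metis append_butlast_last_id)
    thus ?thesis by (metis Bw_snoc T_simps(10))
  qed
  have "last e1 \<in> gedges S'" "last e2 \<in> gedges S'" using e(1,2) Ed_end_edges good_edge by auto
  moreover have "last e1 \<noteq> last e2" using Ed_last_inj e by blast
  ultimately have "gbw S' (last e1) \<noteq> [] \<and> gbw S' (last e2) \<noteq> [] \<and> last (gbw S' (last e1)) \<noteq> last (gbw S' (last e2))"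
    using S1_bw_distinct[of "last e1" "last e2"] m e(3,4) by (simp add: merging_def)
  moreover obtain z1 z2 where "gbw S'' e1 = z1 @ gbw S' (last e1)" "gbw S'' e2 = z2 @ gbw S' (last e2)"
    using F e(1,2) by metis
  ultimately show ?thesis by simp
qed

lemma S2_rauzy_scheme:
  assumes "\<not> is_cycle S''"
  shows "rauzy_scheme S'' W"
proof -
  obtain u0 where u0: "P u0" using assms by (auto simp: is_cycle_def)
  then obtain b m where b: "branching b" and m: "merging m" by (rule branching_merging_exist)
  have kinds: "distr S'' u \<longleftrightarrow> branching u" "coll S'' u \<longleftrightarrow> merging u" if "u \<in> gverts S''" for u
    using that T_distr_iff T_coll_iff by (auto simp: S2_T branching_def merging_def)
  have 0: "graph_with_words S''"
    unfolding graph_with_words_def well_formed_def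
  proof (intro conjI ballI)
    show "finite (gverts S'')"
      by (rule finite_subset[OF _ finite_S1_verts]) (auto simp: persistent_vert)
    show "distr S'' u \<or> coll S'' u" if "u \<in> gverts S''" for u
      using kinds[OF that] that S1_distr_or_coll persistent_vert by (auto simp: branching_def merging_def)
  qed (use finite_Ed Ed_src Ed_tgt S2_strongly_connected in auto)
  have 1: "1 < card (gedges S'')"
  proof -
    have "distr S'' b" using b kinds by (simp add: branching_def)
    hence "1 < card {e \<in> Ed. gsrc S'' e = b}" by (simp add: distr_def outdeg_def)
    also have "\<dots> \<le> card Ed" using finite_Ed by (intro card_mono) auto
    finally show ?thesis by simp
  qed
  have 3: "Fw S'' s = Bw S'' s" if "symmetric_path S'' s" for s
    using S2_symmetric_concat[OF that] S1_Fw_eq_Bw by simp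
  have 4: "k \<le> occ s1 s2" if "symmetric_path S'' s1" "symmetric_path S'' s2" "k \<le> occ (Fw S'' s1) (Fw S'' s2)" for s1 s2 k
    using S2_occ_Fw_le[OF that(1,2)] that(3) by simp
  show ?thesis
    unfolding rauzy_scheme_def lfactor_sublist
    using 0 1 3 4 S2_gfw_factor[OF _ b] S2_gbw_factor[OF _ m] S2_factor_covered[OF _ b m] S2_marker
      S2_fw_distinct S2_bw_distinct kinds
    by (intro conjI; simp (no_asm_use) only: T_simps(6); blast)
qed

section \<open>Periodicity\<close>

lemma periodicI:
  assumes "0 < d" "\<And>n. W n = W (n + d)"
  shows "periodic W"
proof -
  have "W (r + k * d) = W r" for r k
  proof (induction k)
    case (Suc k)
    thus ?case using assms(2)[of "r + k * d"] by (simp add: algebra_simps)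
  qed simp
  hence "W n = W (n mod d)" for n using mod_mult_div_eq[of n d] by (metis add.commute mult.commute)
  thus ?thesis unfolding periodic_def using assms(1) by (intro exI[of _ "map W [0..<d]"]) simp
qed

lemma nth_shift:
  assumes "w @ z = d @ w" "j + length d < length w"
  shows "w ! (j + length d) = w ! j"
proof -
  have "w ! (j + length d) = (d @ w) ! (j + length d)" unfolding assms(1)[symmetric] using assms(2) by (simp add: nth_append)
  thus ?thesis by (simp add: nth_append)
qed

text \<open>Without persistent vertices every good path winds around one cycle, and the length of the word
  read along the cycle is a period of \<open>W\<close>. The cycle is started at some \<open>v\<^sub>i\<^sub>j\<close> to ensure that this
  word is nonempty.\<close>

lemma no_persistent_periodic:
  assumes nP: "\<And>u. \<not> P u"
  shows "periodic W"
proof -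
  obtain x where x: "x \<in> xs_in S v" using card_xs by (metis card.empty equals0I not_less_zero)
  hence "OldE x \<in> good_edges" "gtgt S' (OldE x) = InA x" by (auto simp: good_edges_iff xs_iff)
  then obtain \<epsilon> where e: "\<epsilon> \<in> good_edges" "gsrc S' \<epsilon> = InA x" using good_out_edge by metis
  then obtain y where y: "\<epsilon> = New x y" by (cases \<epsilon>) (auto split: if_splits)
  have ne: "gF S' \<epsilon> \<noteq> []" using e(1) good_edge[OF e(1)] gfw_nonempty[of y] v_tgt
    by (auto simp: y gF_S1 ys_iff)
  obtain p where p: "gpath (\<epsilon> # p @ [\<epsilon>])" using gpath_between e(1) e(1) .
  let ?c = "\<epsilon> # p"
  let ?d = "FF S' ?c"
  have "0 < length ?d" using ne by simp
  moreover have "W n = W (n + length ?d)" for n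
  proof -
    \<comment> \<open>Bounds the front word of a first edge. With \<open>u\<close> at least
      \<open>M\<close> letters into the factor, it is read by later edges only, whose contributions
      \<open>FF\<close> stay the same when further edges are prepended.\<close>
    define M where "M = (\<Sum>\<delta>\<in>gedges S'. length (gfw S' \<delta>))"
    \<comment> \<open>Just long enough to contain both positions \<open>n\<close> and
      \<open>n + length ?d\<close>.\<close>
    define u where "u = map W [0..<Suc (n + length ?d)]"
    have "factor u W" unfolding factor_def u_def by (rule exI[of _ 0]) simp
    then obtain i where i: "M \<le> i" "map W [i..<i + length u] = u" using recurrentD[OF rec] by metis
    let ?a = "map W [i - M..<i]"
    have "map W [i - M..<i + length u] = ?a @ u"
      using i by (metis diff_le_self le_add1 map_append upt_append)
    moreover have "factor (map W [i - M..<i + length u]) W"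
      unfolding factor_def by (rule exI[of _ "i - M"]) (use i(1) in simp)
    ultimately have "factor (?a @ u) W" by simp
    then obtain s where s: "symmetric_path S' s" "set s \<subseteq> good_edges" "sublist (?a @ u) (Fw S' s)"
      using good_path_through[OF e(1) e(1)] by metis
    obtain h t where ht: "s = h # t" using symmetric_path_nonempty[OF s(1)] by (cases s) auto
    have h: "h \<in> good_edges" using s(2) ht by simp
    have "length (gfw S' h) \<le> M"
      unfolding M_def by (rule member_le_sum[OF good_edge[OF h]]) (use finite_S1_edges in auto)
    hence hM: "length (gfw S' h) \<le> length ?a" using i(1) by simp
    obtain A B where "Fw S' s = A @ (?a @ u) @ B" using s(3) by (auto simp: sublist_def)
    hence eq: "gfw S' h @ FF S' t = (A @ ?a) @ (u @ B)" by (simp add: ht Fw_Cons)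
    have "length (gfw S' h) \<le> length (A @ ?a)" using hM by simp
    then obtain z where z: "FF S' t = z @ u @ B" using append_cut_prefix[OF eq] by metis
    obtain q where q: "gpath (\<epsilon> # q @ [h])" using gpath_between e(1) h .
    let ?s = "\<epsilon> # q @ s"
    have ps: "is_path S' ?s" using is_path_join[of S' "\<epsilon> # q" h t] q s(1) by (simp add: gpath_def symmetric_path_def ht)
    have pcs: "is_path S' (?c @ ?s)" using is_path_join[of S' ?c \<epsilon> "q @ s"] p ps by (simp add: gpath_def)
    have gs: "set ?s \<subseteq> good_edges" "set (?c @ ?s) \<subseteq> good_edges" using p q s(2) by (auto simp: gpath_def)
    \<comment> \<open>One more turn around the cycle in front of \<open>?s\<close> begins with the
      same edge, so in the absence of choices it begins with all of \<open>?s\<close>. This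
      self-overlap gives the period.\<close>
    have "prefix ?s (?c @ ?s) \<or> prefix (?c @ ?s) ?s"
      by (rule path_determined[OF ps pcs gs]) (use nonpersistent_out_unique[OF nP] in auto)
    moreover have "\<not> prefix (?c @ ?s) ?s" using prefix_length_le[of "?c @ ?s" ?s] by auto
    ultimately obtain r where r: "?c @ ?s = ?s @ r" by (auto simp: prefix_def)
    let ?w = "FF S' ?s"
    have "FF S' (?c @ ?s) = FF S' (?s @ r)" unfolding r ..
    hence shift: "?w @ FF S' r = ?d @ ?w" by simp
    define X where "X = FF S' (\<epsilon> # q) @ gF S' h @ z"
    have w: "?w = X @ u @ B" using z by (simp add: X_def ht)
    have lu: "length u = Suc (n + length ?d)" by (simp add: u_def)
    have "?w ! (length X + n + length ?d) = ?w ! (length X + n)"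
      by (rule nth_shift[OF shift]) (unfold w, simp add: lu)
    hence "u ! (n + length ?d) = u ! n" unfolding w by (simp add: nth_append lu add.assoc)
    moreover have "u ! k = W k" if "k < Suc (n + length ?d)" for k
      using that unfolding u_def by (simp del: upt_Suc)
    ultimately show ?thesis by simp
  qed
  ultimately show ?thesis by (rule periodicI)
qed

end

theorem theorem4p1:
  fixes W :: "nat \<Rightarrow> 'a" and S :: "('v, 'e, 'a) gw" and v :: 'e
  assumes "recurrent W" and "rauzy_scheme S W" and "support_edge S v"
  shows "strongly_connected (S2 S W v) \<and>
         (is_cycle (S2 S W v) \<longrightarrow> periodic W) \<and>
         (\<not> is_cycle (S2 S W v) \<longrightarrow> rauzy_scheme (S2 S W v) W)"
proof -
  interpret evolution S W v
    using assms by unfold_locales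
  show ?thesis
    using S2_strongly_connected cycle_no_persistent no_persistent_periodic S2_rauzy_scheme by blast
qed

end
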